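(* Let $\lambda(\sigma)=1/\sqrt{\sigma}$ for $\sigma>0$. Then there is a sequence $(\rho_n)_{n\in\mathbb{N}}\subset L^1(\mathbb{R}^3)\cap L^\infty(\mathbb{R}^3)$ of spherically symmetric densities such that for all $n\in\mathbb{N}$: $\rho_n\ge0$, $\operatorname{supp}\rho_n\subset B_2$ and $\|\rho_n\|_\infty\le1$, but $$\|D^2U^M_{\rho_n}\|_q\to\infty\quad\text{for } n\to\infty$$ if $2<q<6$.
   Context: $B_2$ is the ball in $\mathbb{R}^3$ of radius $2$ centred at the origin. For $\rho\in L^1(\mathbb{R}^3)\cap L^\infty(\mathbb{R}^3)$ the Newtonian potential (gravitational constant $1$) is $U^N_\rho(x)=-\int_{\mathbb{R}^3}\frac{\rho(y)}{|x-y|}\,dy$, with gradient $\nabla U^N_\rho(x)=\int_{\mathbb{R}^3}\frac{x-y}{|x-y|^3}\rho(y)\,dy$. The Mondian potential is $U^M_\rho=U^N_\rho+U^\lambda_\rho$ with $$U^\lambda_\rho(x)=\frac1{4\pi}\int_{\mathbb{R}^3}\lambda(|\nabla U^N_\rho(y)|)\,\nabla U^N_\rho(y)\cdot\left(\frac{x-y}{|x-y|^3}+\frac{y}{|y|^3}\right)dy,$$ where $\lambda(|u|)u=0$ if $u=0$. For spherically symmetric $\rho$ one has $\nabla U^M_\rho=\nabla U^N_\rho+\lambda(|\nabla U^N_\rho|)\nabla U^N_\rho$. $D^2U^M_\rho$ denotes the matrix of weak second derivatives, and $\|\cdot\|_q$ is the $L^q(\mathbb{R}^3)$ norm (equal to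 $+\infty$ if the function is not in $L^q$). *)

theory Defs
  imports "HOL-Analysis.Analysis" "HOL-Probability.Essential_Supremum"
begin

type_synonym R3 = "real ^ 3"

subsection \<open>Lebesgue spaces\<close>

definition Linf_norm :: "(R3 \<Rightarrow> 'b::real_normed_vector) \<Rightarrow> ereal" where
  "Linf_norm f = esssup lborel (\<lambda>x. ereal (norm (f x)))"

definition in_L1_Linf :: "(R3 \<Rightarrow> real) \<Rightarrow> bool" where
  "in_L1_Linf f \<longleftrightarrow> integrable lborel f \<and> Linf_norm f < \<infinity>"

text \<open>The value is \<open>\<infinity>\<close> exactly when \<open>f\<close> is not in \<open>L\<^sup>q\<close>. For matrix-valued \<open>f\<close>, the norm
  on \<open>real^3^3\<close> is the Frobenius norm.\<close>

definition Lq_norm :: "real \<Rightarrow> (R3 \<Rightarrow> 'b::real_normed_vector) \<Rightarrow> ennreal" where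
  "Lq_norm q f =
     (let I = (\<integral>\<^sup>+ x. ennreal (norm (f x) powr q) \<partial>lborel)
      in if f \<in> borel_measurable lborel \<and> I < \<infinity> then ennreal (enn2real I powr (1 / q)) else \<infinity>)"

definition locally_integrable :: "(R3 \<Rightarrow> 'b::{banach, second_countable_topology}) \<Rightarrow> bool" where
  "locally_integrable f \<longleftrightarrow>
     f \<in> borel_measurable lborel \<and> (\<forall>K. compact K \<longrightarrow> set_integrable lborel K f)"


subsection \<open>Weak second derivatives\<close>

definition supp :: "(R3 \<Rightarrow> 'b::zero) \<Rightarrow> R3 set" where
  "supp f = closure {x. f x \<noteq> 0}"

definition partial_deriv :: "3 \<Rightarrow> (R3 \<Rightarrow> real) \<Rightarrow> (R3 \<Rightarrow> real)" where
  "partial_deriv i f = (\<lambda>x. frechet_derivative f (at x) (axis i 1))"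

text \<open>\<open>C\<^sup>\<infinity>\<close> functions of compact support. Differentiability of all iterated partial
  derivatives also makes all of them continuous.\<close>

definition test_function :: "(R3 \<Rightarrow> real) \<Rightarrow> bool" where
  "test_function \<phi> \<longleftrightarrow>
     (\<forall>is. foldr partial_deriv is \<phi> differentiable_on UNIV) \<and> compact (supp \<phi>)"

definition has_weak_hessian :: "(R3 \<Rightarrow> real) \<Rightarrow> (R3 \<Rightarrow> real ^ 3 ^ 3) \<Rightarrow> bool" where
  "has_weak_hessian U H \<longleftrightarrow>
     locally_integrable U \<and> locally_integrable H \<and>
     (\<forall>\<phi> i j. test_function \<phi> \<longrightarrow>
        (LINT x|lborel. U x * partial_deriv i (partial_deriv j \<phi>) x) =
        (LINT x|lborel. H x $ i $ j * \<phi> x))"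


subsection \<open>Newtonian and Mondian potentials\<close>

definition spherically_symmetric :: "(R3 \<Rightarrow> real) \<Rightarrow> bool" where
  "spherically_symmetric \<rho> \<longleftrightarrow> (\<forall>x y. norm x = norm y \<longrightarrow> \<rho> x = \<rho> y)"

definition newton_potential :: "(R3 \<Rightarrow> real) \<Rightarrow> R3 \<Rightarrow> real" where
  "newton_potential \<rho> x = - (LINT y|lborel. \<rho> y / norm (x - y))"

definition newton_gradient :: "(R3 \<Rightarrow> real) \<Rightarrow> R3 \<Rightarrow> R3" where
  "newton_gradient \<rho> x = (LINT y|lborel. \<rho> y *\<^sub>R ((x - y) /\<^sub>R norm (x - y) ^ 3))"

text \<open>The convention that \<open>\<lambda>(|u|) u = 0\<close> for \<open>u = 0\<close> holds automatically, whatever the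
  value of \<open>lam 0\<close>.\<close>

definition lambda_potential :: "(real \<Rightarrow> real) \<Rightarrow> (R3 \<Rightarrow> real) \<Rightarrow> R3 \<Rightarrow> real" where
  "lambda_potential lam \<rho> x =
     1 / (4 * pi) *
     (LINT y|lborel.
        (lam (norm (newton_gradient \<rho> y)) *\<^sub>R newton_gradient \<rho> y) \<bullet>
        ((x - y) /\<^sub>R norm (x - y) ^ 3 + y /\<^sub>R norm y ^ 3))"

definition mond_potential :: "(real \<Rightarrow> real) \<Rightarrow> (R3 \<Rightarrow> real) \<Rightarrow> R3 \<Rightarrow> real" where
  "mond_potential lam \<rho> x = newton_potential \<rho> x + lambda_potential lam \<rho> x"

end

theory Submission
  imports Defs "HOL-Real_Asymp.Real_Asymp"
begin

text \<open>The sequence is constant. Put mass on the shell \<open>1 \<le> |y|\<^sup>2 \<le> 2\<close> only, with the density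
  \<open>1/(2\<pi>|y|)\<close>, so that the mass inside the sphere \<open>|x|\<^sup>2 = s\<close> is \<open>M(s) = s - 1\<close> on the shell.
  By Newton's theorem \<open>\<nabla>U\<^sup>N = M x/|x|\<^sup>3\<close>, and the \<open>\<lambda>\<close>-part of the gradient is \<open>\<surd>M x/|x|\<^sup>2\<close>. The square
  root makes the radial second derivative blow up like \<open>(s - 1) powr (-1/2)\<close> at the inner edge of the
  shell, which is locally integrable but in no \<open>L\<^sup>q\<close> with \<open>q \<ge> 2\<close>.

  All potentials are integrals of functions of \<open>(y \<bullet> e, |y|\<^sup>2)\<close> for a unit vector \<open>e\<close>. By the hat-box
  theorem of Archimedes this pair has density \<open>\<pi>\<close> on \<open>{(u, s). u\<^sup>2 \<le> s}\<close>, so that no spherical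
  coordinates are needed. The weak derivatives come from the fact that a directional derivative has
  integral zero: averaging it over unit translations gives a difference \<open>F(x + e) - F(x)\<close>.\<close>

section \<open>Axially symmetric integrals\<close>

text \<open>The factor 1/(2 pi |y|) is dictated by the hat-box density: the spheres
  \<open>|y|^2 = s\<close> have volume element \<open>2 * pi * sqrt s\<close> ds, so this density
  gives every s in [1, 2] the same mass. The inner edge lies at positive radius: there the volume
  weight is bounded below, while the enclosed mass still vanishes linearly, so the q-th power of the
  singular term is (s - 1) powr (-q/2), with a logarithmic divergence already at q = 2. Cancellation
  is excluded by looking at the radial second derivative alone, to which the Newtonian part
  contributes a positive amount.

  No singular integral is differentiated. The gradient formula only serves as input to the integrand
  of the lambda part; both potentials are then evaluated in closed form as primitives, in
  \<open>s = |x|^2\<close>, of continuous fields. What remains delicate is that the sum of these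
  fields is not differentiable on the spheres \<open>|x|^2 = 1\<close> and \<open>|x|^2 = 2\<close>.
  A line meets them in finitely many points, which the fundamental theorem of calculus tolerates for
  a continuous primitive, so no surface terms arise.\<close>

lemma Basis_R3: "(Basis :: R3 set) = {axis 1 1, axis 2 1, axis 3 1}"
  by (auto simp: Basis_vec_def exhaust_3) (metis exhaust_3)

text \<open>The first coordinate is split off from the pair of the other two, so that Fubini
  integrates over the plane orthogonal to \<open>axis 1 1\<close>.\<close>

definition R3_of :: "real \<times> real \<times> real \<Rightarrow> R3" where
  "R3_of p = fst p *\<^sub>R axis 1 1 + fst (snd p) *\<^sub>R axis 2 1 + snd (snd p) *\<^sub>R axis 3 1"

lemma borel_measurable_R3_of [measurable]: "R3_of \<in> borel_measurable borel"
  unfolding R3_of_def by (intro borel_measurable_continuous_onI continuous_intros)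

lemma inner_R3_of: "R3_of p \<bullet> axis 1 1 = fst p" "R3_of p \<bullet> R3_of p = (fst p)\<^sup>2 + snd p \<bullet> snd p"
  by (cases p; simp add: R3_of_def inner_vec_def sum_3 axis_def power2_eq_square)+

lemma distr_lborel_R3_of: "distr lborel borel R3_of = lborel"
proof (rule lborel_eqI[symmetric])
  fix l u :: R3
  assume lu: "\<And>b. b \<in> Basis \<Longrightarrow> l \<bullet> b \<le> u \<bullet> b"
  let ?l = "(l $ 1, l $ 2, l $ 3)" and ?u = "(u $ 1, u $ 2, u $ 3)"
  have le: "l $ 1 \<le> u $ 1" "l $ 2 \<le> u $ 2" "l $ 3 \<le> u $ 3"
    using lu[of "axis 1 1"] lu[of "axis 2 1"] lu[of "axis 3 1"] by (simp_all add: Basis_R3 inner_axis)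
  have "R3_of -` box l u = box ?l ?u"
    by (auto simp: R3_of_def mem_box_cart forall_3 axis_def mem_box Basis_prod_def)
  moreover have "(\<Prod>b\<in>Basis. (?u - ?l) \<bullet> b) = (u $ 1 - l $ 1) * ((u $ 2 - l $ 2) * (u $ 3 - l $ 3))"
    by (auto simp: Basis_prod_def)
  moreover have "(\<Prod>b\<in>Basis. (u - l) \<bullet> b) = (u $ 1 - l $ 1) * ((u $ 2 - l $ 2) * (u $ 3 - l $ 3))"
    by (simp add: Basis_R3 axis_eq_axis inner_axis)
  ultimately show "emeasure (distr lborel borel R3_of) (box l u) = (\<Prod>b\<in>Basis. (u - l) \<bullet> b)"
    using le by (auto simp: emeasure_distr emeasure_lborel_box_eq Basis_prod_def)
qed simp

text \<open>On a box the preimage under \<open>f\<close> is the image under its inverse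
  \<open>g\<close>, and orthogonal images keep their \<open>lebesgue\<close> measure; the preimage
  is Borel, so this is also its \<open>lborel\<close> measure.\<close>

lemma distr_lborel_orthogonal:
  fixes f :: "R3 \<Rightarrow> R3"
  assumes "orthogonal_transformation f"
  shows "distr lborel borel f = lborel"
proof (rule lborel_eqI[symmetric])
  fix l u :: R3
  assume lu: "\<And>b. b \<in> Basis \<Longrightarrow> l \<bullet> b \<le> u \<bullet> b"
  obtain g where g: "orthogonal_transformation g" "\<And>x. g (f x) = x" "\<And>x. f (g x) = x"
    by (metis assms bij_inv_eq_iff orthogonal_transformation_bij orthogonal_transformation_inv)
  have [measurable]: "f \<in> borel_measurable borel"
    by (intro borel_measurable_continuous_onI linear_continuous_on
        linear_conv_bounded_linear[THEN iffD1] orthogonal_transformation_linear assms)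
  have "f -` box l u = g ` box l u"
    by (auto simp: g image_iff) (metis g(2))
  moreover have "measure lebesgue (g ` box l u) = measure lebesgue (box l u)" "g ` box l u \<in> lmeasurable"
    by (rule measure_orthogonal_image measurable_orthogonal_image; simp add: g)+
  moreover have "f -` box l u \<in> sets borel"
    using measurable_sets[of f borel borel "box l u"] by auto
  ultimately have "emeasure lebesgue (f -` box l u) = emeasure lebesgue (box l u)"
      "f -` box l u \<in> sets lborel"
    by (metis emeasure_eq_measure2 lmeasurable_box) (simp add: \<open>f -` box l u \<in> sets borel\<close>)
  then have "emeasure lborel (f -` box l u) = emeasure lborel (box l u)"
    by simp
  then show "emeasure (distr lborel borel f) (box l u) = (\<Prod>b\<in>Basis. (u - l) \<bullet> b)"
    using lu by (simp add: emeasure_distr)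
qed simp

text \<open>The disc \<open>p \<bullet> p \<le> t\<close> has area pi t, linear in t, hence the
  constant density. This is the planar fact behind the hat-box theorem.\<close>

lemma distr_lborel_square_norm:
  "distr (lborel :: (real \<times> real) measure) borel (\<lambda>p. p \<bullet> p) = density lborel (\<lambda>t. ennreal pi * indicator {0..} t)"
proof (rule measure_eqI_generator_eq[where E = "range atMost" and \<Omega> = UNIV and A = "\<lambda>n. {..real n}"])
  show "Int_stable (range (atMost :: real \<Rightarrow> _))"
    by (auto simp: Int_stable_def)
  show "sets (distr (lborel :: (real \<times> real) measure) borel (\<lambda>p. p \<bullet> p)) = sigma_sets UNIV (range atMost)"
    "sets (density lborel (\<lambda>t. ennreal pi * indicator {0..} t)) = sigma_sets UNIV (range (atMost::real \<Rightarrow> _))"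
    by (simp_all add: borel_eq_atMost)
  have *: "emeasure (distr (lborel :: (real \<times> real) measure) borel (\<lambda>p. p \<bullet> p)) {..t} = ennreal (pi * max 0 t)" for t :: real
  proof (cases "t < 0")
    case True
    then have "(\<lambda>p::real\<times>real. p \<bullet> p) -` {..t} = {}"
      using inner_ge_zero[where 'a = "real \<times> real"] by (auto simp del: inner_Pair inner_ge_zero) (meson dual_order.trans leD)
    then show ?thesis using True by (simp add: emeasure_distr)
  next
    case False
    then have "(\<lambda>p::real\<times>real. p \<bullet> p) -` {..t} = cball 0 (sqrt t)"
      by (auto simp: norm_eq_sqrt_inner simp del: inner_Pair)
    then show ?thesis using False
      by (simp add: emeasure_distr emeasure_cball unit_ball_vol_2)
  qed
  have **: "emeasure (density lborel (\<lambda>t. ennreal pi * indicator {0..} t)) {..t} = ennreal (pi * max 0 t)" for t :: real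
  proof -
    have "emeasure (density lborel (\<lambda>t. ennreal pi * indicator {0..} t)) {..t} = 
      (\<integral>\<^sup>+x. ennreal pi * indicator {0..t} x \<partial>lborel)"
      by (subst emeasure_density) (auto intro!: nn_integral_cong split: split_indicator)
    also have "\<dots> = ennreal (pi * max 0 t)"
      by (subst nn_integral_cmult_indicator) (auto simp: ennreal_mult max_def ennreal_mult'')
    finally show ?thesis .
  qed
  show "emeasure (distr (lborel :: (real \<times> real) measure) borel (\<lambda>p. p \<bullet> p)) X =
    emeasure (density lborel (\<lambda>t. ennreal pi * indicator {0..} t)) X" if "X \<in> range atMost" for X :: "real set"
    using that * ** by auto
  show "emeasure (distr (lborel :: (real \<times> real) measure) borel (\<lambda>p. p \<bullet> p)) {..real n} \<noteq> \<infinity>" for n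
    using * by simp
qed (auto simp: real_arch_simple)

text \<open>After rotating \<open>e\<close> to the first axis, fix the height a. The rest of y is a
  planar vector q with \<open>|y|^2 = a^2 + |q|^2\<close>, so s is the planar square norm shifted by
  a^2 and keeps density pi on \<open>s \<ge> a^2\<close>.\<close>

lemma distr_lborel_axial:
  fixes e :: R3
  assumes "norm e = 1"
  shows "distr lborel borel (\<lambda>y. (y \<bullet> e, y \<bullet> y)) =
    density (lborel :: (real \<times> real) measure) (\<lambda>(u, s). ennreal pi * indicator {u\<^sup>2..} s)"
proof -
  have [measurable]: "{p::real\<times>real. (fst p)\<^sup>2 \<le> snd p} \<in> sets (borel \<Otimes>\<^sub>M borel)"
    unfolding borel_prod by (intro borel_closed closed_Collect_le continuous_intros)
  have ind: "(\<lambda>(u::real, s). ennreal pi * indicator {u\<^sup>2..} s)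
      = (\<lambda>p. ennreal pi * indicator {p. (fst p)\<^sup>2 \<le> snd p} p)"
    by (auto split: split_indicator)
  let ?h = "\<lambda>(e::R3) y. (y \<bullet> e, y \<bullet> y)"
  have [measurable]: "?h e \<in> borel_measurable borel" for e
    by (intro borel_measurable_continuous_onI continuous_intros)
  have "\<exists>f. orthogonal_transformation f \<and> f (axis 1 1 :: R3) = e"
    by (rule orthogonal_transformation_exists[of "axis 1 1" e]) (use assms in auto)
  then obtain f where f: "orthogonal_transformation f" "f (axis 1 1 :: R3) = e"
    by blast
  have [measurable]: "f \<in> borel_measurable borel"
    by (intro borel_measurable_continuous_onI linear_continuous_on
        linear_conv_bounded_linear[THEN iffD1] orthogonal_transformation_linear f)
  have "distr lborel borel (?h e) = distr (distr lborel borel f) borel (?h e)"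
    by (simp add: distr_lborel_orthogonal f)
  also have "\<dots> = distr lborel borel (\<lambda>y. ?h e (f y))"
    by (subst distr_distr) (auto simp: comp_def)
  also have "\<dots> = distr lborel borel (?h (axis 1 1))"
    using f by (intro distr_cong) (auto simp: orthogonal_transformation_def f(2)[symmetric])
  also have "\<dots> = density (lborel :: (real \<times> real) measure) (\<lambda>(u, s). ennreal pi * indicator {u\<^sup>2..} s)"
  proof (rule measure_eqI)
    fix A assume "A \<in> sets (distr lborel borel (?h (axis 1 1)))"
    then have A [measurable]: "A \<in> sets (borel :: (real \<times> real) measure)" by simp
    then have A' [measurable]: "A \<in> sets (borel \<Otimes>\<^sub>M borel)" unfolding borel_prod .
    have "emeasure (distr lborel borel (?h (axis 1 1))) A
        = (\<integral>\<^sup>+y. indicator A (?h (axis 1 1) y) \<partial>distr lborel borel R3_of)"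
      by (simp add: distr_lborel_R3_of flip: nn_integral_indicator) (subst nn_integral_distr; simp)
    also have "\<dots> = (\<integral>\<^sup>+p. indicator A (fst p, (fst p)\<^sup>2 + snd p \<bullet> snd p) \<partial>(lborel :: (real \<times> real \<times> real) measure))"
      by (subst nn_integral_distr) (simp_all add: inner_R3_of)
    also have "\<dots> = (\<integral>\<^sup>+a. \<integral>\<^sup>+q. indicator A (a, a\<^sup>2 + q \<bullet> q) \<partial>(lborel :: (real \<times> real) measure) \<partial>lborel)"
      by (subst lborel_prod[symmetric], subst lborel.nn_integral_fst[symmetric]) auto
    also have "\<dots> = (\<integral>\<^sup>+a. \<integral>\<^sup>+t. indicator A (a, a\<^sup>2 + t) \<partial>density lborel (\<lambda>t. ennreal pi * indicator {0..} t) \<partial>lborel)"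
      by (subst distr_lborel_square_norm[symmetric], subst nn_integral_distr) auto
    also have "\<dots> = (\<integral>\<^sup>+a. \<integral>\<^sup>+t. ennreal pi * indicator {0..} t * indicator A (a, a\<^sup>2 + t) \<partial>lborel \<partial>lborel)"
      by (subst nn_integral_density) auto
    also have "\<dots> = (\<integral>\<^sup>+a. \<integral>\<^sup>+s. ennreal pi * indicator {a\<^sup>2..} s * indicator A (a, s) \<partial>lborel \<partial>lborel)"
    proof (rule nn_integral_cong)
      fix a :: real
      have "(\<integral>\<^sup>+s. ennreal pi * indicator {a\<^sup>2..} s * indicator A (a, s) \<partial>lborel)
        = (\<integral>\<^sup>+t. ennreal pi * indicator {a\<^sup>2..} (a\<^sup>2 + t) * indicator A (a, a\<^sup>2 + t) \<partial>lborel)"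
        by (subst nn_integral_real_affine[where c = 1 and t = "a\<^sup>2"]) auto
      then show "(\<integral>\<^sup>+t. ennreal pi * indicator {0..} t * indicator A (a, a\<^sup>2 + t) \<partial>lborel)
        = (\<integral>\<^sup>+s. ennreal pi * indicator {a\<^sup>2..} s * indicator A (a, s) \<partial>lborel)"
        by (auto intro!: nn_integral_cong split: split_indicator)
    qed
    also have "\<dots> = (\<integral>\<^sup>+p. (case p of (u, s) \<Rightarrow> ennreal pi * indicator {u\<^sup>2..} s) * indicator A p \<partial>lborel)"
      unfolding ind
      by (subst lborel_prod[symmetric], subst lborel.nn_integral_fst[symmetric])
        (auto intro!: nn_integral_cong split: split_indicator)
    also have "\<dots> = emeasure (density lborel (\<lambda>(u, s). ennreal pi * indicator {u\<^sup>2..} s)) A"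
      unfolding ind
      by (subst emeasure_density) (auto simp: lborel_prod[symmetric])
    finally show "emeasure (distr lborel borel (?h (axis 1 1))) A =
      emeasure (density lborel (\<lambda>(u, s). ennreal pi * indicator {u\<^sup>2..} s)) A" .
  qed simp
  finally show ?thesis .
qed

lemma indicator_axial: "indicator {u\<^sup>2..} s = indicator {- sqrt s..sqrt s} u"
proof -
  have "u\<^sup>2 \<le> s \<longleftrightarrow> \<bar>u\<bar> \<le> sqrt s"
    using real_le_rsqrt[of "\<bar>u\<bar>" s] sqrt_ge_absD by auto
  then show ?thesis by (auto simp: abs_le_iff split: split_indicator)
qed

lemma measurable_axial_weight [measurable]:
  "(\<lambda>p. indicator {- sqrt (snd p)..sqrt (snd p)} (fst p) :: 'a::{topological_space,zero_neq_one}) \<in> borel_measurable (borel \<Otimes>\<^sub>M borel)"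
  unfolding indicator_def atLeastAtMost_iff by measurable

text \<open>The weight \<open>indicator {- sqrt s..sqrt s}\<close> vanishes for \<open>s < 0\<close>, because \<open>sqrt\<close> is then negative.\<close>

lemma integral_axial:
  fixes F :: "real \<times> real \<Rightarrow> real" and e :: R3
  assumes e: "norm e = 1" and [measurable]: "F \<in> borel_measurable (borel \<Otimes>\<^sub>M borel)" "G \<in> borel_measurable borel"
    and int: "integrable lborel (\<lambda>y. F (y \<bullet> e, y \<bullet> y))"
    and G: "AE s in lborel. (\<integral>u. F (u, s) * indicator {- sqrt s..sqrt s} u \<partial>lborel) = G s"
  shows "(\<integral>y. F (y \<bullet> e, y \<bullet> y) \<partial>lborel) = pi * (\<integral>s. G s \<partial>lborel)"
proof -
  have [measurable]: "F \<in> borel_measurable borel"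
    using assms(2) by (simp add: borel_prod)
  have [measurable]: "(\<lambda>y. (y \<bullet> e, y \<bullet> y)) \<in> borel_measurable borel"
    by (intro borel_measurable_continuous_onI continuous_intros)
  define w :: "real \<times> real \<Rightarrow> real" where "w p = pi * indicator {- sqrt (snd p)..sqrt (snd p)} (fst p)" for p
  have w [measurable]: "w \<in> borel_measurable (borel \<Otimes>\<^sub>M borel)" unfolding w_def by measurable
  then have [measurable]: "w \<in> borel_measurable borel" by (simp add: borel_prod)
  have w0: "w p \<ge> 0" for p by (simp add: w_def)
  have distr: "distr lborel borel (\<lambda>y. (y \<bullet> e, y \<bullet> y)) = density lborel w"
    unfolding distr_lborel_axial[OF e]
    by (intro arg_cong[where f = "density lborel"] ext)
      (simp add: w_def indicator_axial case_prod_beta' split: split_indicator)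
  have "integrable (distr lborel borel (\<lambda>y. (y \<bullet> e, y \<bullet> y))) F"
    using int by (subst integrable_distr_eq) auto
  then have int': "integrable (lborel \<Otimes>\<^sub>M lborel) (\<lambda>p. w p * F p)"
    unfolding distr using w0 by (subst (asm) integrable_density) (auto simp: lborel_prod)
  have "(\<integral>y. F (y \<bullet> e, y \<bullet> y) \<partial>lborel) = (\<integral>p. F p \<partial>density lborel w)"
    by (subst distr[symmetric], subst integral_distr) auto
  also have "\<dots> = (\<integral>p. w p * F p \<partial>(lborel \<Otimes>\<^sub>M lborel))"
    using w0 by (subst integral_density) (auto simp: lborel_prod)
  \<comment> \<open>The inner integral runs over the heights on one sphere \<open>|y|^2 = s\<close>.
    Since \<open>G\<close> is prescribed only for almost every s, callers may drop the sphere
    through the singularity of their kernel.\<close>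
  also have "\<dots> = (\<integral>s. \<integral>u. w (u, s) * F (u, s) \<partial>lborel \<partial>lborel)"
    using lborel_pair.integral_snd[of "\<lambda>u s. w (u, s) * F (u, s)"] int' by (simp add: case_prod_beta')
  also have "\<dots> = (\<integral>s. pi * G s \<partial>lborel)"
  proof (rule integral_cong_AE)
    have "(\<integral>u. w (u, s) * F (u, s) \<partial>lborel) = pi * (\<integral>u. F (u, s) * indicator {- sqrt s..sqrt s} u \<partial>lborel)" for s
      by (simp add: w_def mult_ac flip: integral_mult_right_zero)
    with G show "AE s in lborel. (\<integral>u. w (u, s) * F (u, s) \<partial>lborel) = pi * G s"
      by auto
  qed measurable
  finally show ?thesis by simp
qed

text \<open>The weight is pi times the length of the height interval; for \<open>s < 0\<close> it is
  negative and \<open>ennreal\<close> truncates it to 0, matching the empty interval. The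
  \<open>ennreal\<close> form serves both the integrability proofs and the final divergence.\<close>

lemma nn_integral_radial:
  assumes [measurable]: "f \<in> borel_measurable borel"
  shows "(\<integral>\<^sup>+y. f (y \<bullet> y) \<partial>(lborel :: R3 measure)) = (\<integral>\<^sup>+s. ennreal (2 * pi * sqrt s) * f s \<partial>lborel)"
proof -
  let ?h = "\<lambda>y::R3. (y \<bullet> axis 1 1, y \<bullet> y)"
  have [measurable]: "?h \<in> borel_measurable borel"
    by (intro borel_measurable_continuous_onI continuous_intros)
  have [measurable]: "(\<lambda>p. f (snd p)) \<in> borel_measurable (borel :: (real\<times>real) measure)"
    by (simp flip: borel_prod)
  have [measurable]: "(\<lambda>p. ennreal pi * indicator {- sqrt (snd p)..sqrt (snd p)} (fst p)) \<in> borel_measurable (borel :: (real\<times>real) measure)"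
    by (simp flip: borel_prod)
  have "(\<integral>\<^sup>+y. f (y \<bullet> y) \<partial>(lborel :: R3 measure)) = (\<integral>\<^sup>+p. f (snd p) \<partial>distr lborel borel ?h)"
    by (subst nn_integral_distr) auto
  also have "distr lborel borel ?h = density lborel (\<lambda>p. ennreal pi * indicator {- sqrt (snd p)..sqrt (snd p)} (fst p))"
    by (simp add: distr_lborel_axial norm_axis_1 case_prod_beta' indicator_axial)
  also have "(\<integral>\<^sup>+p. f (snd p) \<partial>\<dots>) = (\<integral>\<^sup>+p. ennreal pi * indicator {- sqrt (snd p)..sqrt (snd p)} (fst p) * f (snd p) \<partial>(lborel \<Otimes>\<^sub>M lborel))"
    by (subst nn_integral_density) (auto simp: lborel_prod)
  also have "\<dots> = (\<integral>\<^sup>+s. \<integral>\<^sup>+u. ennreal pi * f s * indicator {- sqrt s..sqrt s} u \<partial>lborel \<partial>lborel)"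
    by (subst lborel_pair.nn_integral_snd[symmetric]) (auto simp: mult_ac)
  also have "\<dots> = (\<integral>\<^sup>+s. ennreal (2 * pi * sqrt s) * f s \<partial>lborel)"
  proof (rule nn_integral_cong)
    fix s :: real
    show "(\<integral>\<^sup>+u. ennreal pi * f s * indicator {- sqrt s..sqrt s} u \<partial>lborel) = ennreal (2 * pi * sqrt s) * f s"
    proof (cases "s < 0")
      case True
      then have "sqrt s < 0" by simp
      then show ?thesis by (simp add: ennreal_neg mult_nonneg_nonpos)
    next
      case False
      have "ennreal (2 * pi * sqrt s) = ennreal (2 * sqrt s) * ennreal pi"
        using False by (subst ennreal_mult[symmetric]) (auto simp: mult_ac)
      with False show ?thesis
        by (subst nn_integral_cmult_indicator) (auto simp: mult_ac)
    qed
  qed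
  finally show ?thesis .
qed

lemma integrable_radial:
  fixes f :: "real \<Rightarrow> real"
  assumes [measurable]: "f \<in> borel_measurable borel" 
    and "(\<integral>\<^sup>+s. ennreal (2 * pi * sqrt s) * ennreal \<bar>f s\<bar> \<partial>lborel) < \<infinity>"
  shows "integrable (lborel :: R3 measure) (\<lambda>y. f (y \<bullet> y))"
  unfolding integrable_iff_bounded using assms nn_integral_radial[of "\<lambda>s. ennreal \<bar>f s\<bar>"] by simp

text \<open>Local integrability of the gravitational kernel: with the weight \<open>sqrt s\<close>,
  the function 1/s becomes 1/sqrt s, which has the primitive 2 sqrt s.\<close>

lemma integrable_inverse_square_ball:
  "integrable lborel (\<lambda>y::R3. indicator {..L} (y \<bullet> y) / (y \<bullet> y))"
proof (rule integrable_radial)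
  have "(\<integral>\<^sup>+s. ennreal (2 * pi * sqrt s) * ennreal \<bar>indicator {..L} s / s\<bar> \<partial>lborel) \<le>
    (\<integral>\<^sup>+s. ennreal (indicator {0..L} s * (2 * pi / sqrt s)) \<partial>lborel)"
  proof (rule nn_integral_mono)
    fix s :: real
    show "ennreal (2 * pi * sqrt s) * ennreal \<bar>indicator {..L} s / s\<bar> \<le> ennreal (indicator {0..L} s * (2 * pi / sqrt s))"
      by (cases "s \<le> 0") (auto split: split_indicator simp: ennreal_neg mult_nonneg_nonpos real_div_sqrt
          ennreal_mult[symmetric] field_simps)
  qed
  also have "\<dots> < \<infinity>"
  proof (cases "L \<ge> 0")
    case True
    have "((\<lambda>s. 2 * pi / sqrt s) has_integral (4 * pi * sqrt L - 4 * pi * sqrt 0)) {0..L}"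
      using True by (intro fundamental_theorem_of_calculus_interior)
        (auto intro!: derivative_eq_intros continuous_intros
           simp flip: has_real_derivative_iff_has_vector_derivative simp: field_simps)
    from nn_integral_has_integral_lebesgue[OF _ this]
    have "(\<integral>\<^sup>+s. ennreal (indicator {0..L} s * (2 * pi / sqrt s)) \<partial>lborel) = ennreal (4 * pi * sqrt L)"
      using True by simp
    then show ?thesis by simp
  qed (simp add: not_le)
  finally show "(\<integral>\<^sup>+s. ennreal (2 * pi * sqrt s) * ennreal \<bar>indicator {..L} s / s\<bar> \<partial>lborel) < \<infinity>" .
qed simp

text \<open>Majorant at infinity for the lambda part: a field of order 1/|y| times a kernel of order
  1/|y|^3.\<close>

lemma integrable_inverse_fourth_power:
  "integrable lborel (\<lambda>y::R3. indicator {1..} (y \<bullet> y) / (y \<bullet> y)\<^sup>2)"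
proof (rule integrable_radial)
  have "(\<integral>\<^sup>+s. ennreal (2 * pi * sqrt s) * ennreal \<bar>indicator {1..} s / s\<^sup>2\<bar> \<partial>lborel) =
    (\<integral>\<^sup>+s. ennreal (2 * pi * s powr (- 3/2)) * indicator {1..} s \<partial>lborel)"
  proof (rule nn_integral_cong)
    fix s :: real
    have "2 * pi * sqrt s / s\<^sup>2 = 2 * pi * s powr (- 3/2)" if "s \<ge> 1"
      unfolding times_divide_eq_right[symmetric]
      using that by (simp del: times_divide_eq_right add:  powr_half_sqrt[symmetric] powr_diff[symmetric] flip: powr_numeral)
    then show "ennreal (2 * pi * sqrt s) * ennreal \<bar>indicator {1..} s / s\<^sup>2\<bar> = ennreal (2 * pi * s powr (- 3/2)) * indicator {1..} s"
      by (auto split: split_indicator simp: ennreal_mult[symmetric])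
  qed
  also have "\<dots> = ennreal (0 - - 4 * pi * 1 powr (- 1/2))"
  proof (rule nn_integral_FTC_atLeast[where F = "\<lambda>s. - 4 * pi * s powr (- 1/2)"])
    show "((\<lambda>s. - 4 * pi * s powr (- 1/2)) \<longlongrightarrow> 0) at_top"
      by real_asymp
  qed (auto intro!: derivative_eq_intros)
  finally show "(\<integral>\<^sup>+s. ennreal (2 * pi * sqrt s) * ennreal \<bar>indicator {1..} s / s\<^sup>2\<bar> \<partial>lborel) < \<infinity>" by simp
qed simp

section \<open>Integrals of directional derivatives\<close>

text \<open>The integral of \<open>F'\<close> along the segment from x to x + e is F(x + e) - F(x),
  and both terms have the same integral over x. This is integration by parts in a form that admits
  exceptional points, with a set \<open>S\<close> that may depend on the line.\<close>

lemma integral_directional_derivative_eq_0: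
  fixes F F' :: "R3 \<Rightarrow> real" and e :: R3
  assumes F: "integrable lborel F" and F': "integrable lborel F'"
    and cont: "\<And>x. continuous_on {0..1} (\<lambda>t. F (x + t *\<^sub>R e))"
    and deriv: "\<And>x. \<exists>S. finite S \<and> (\<forall>t\<in>{0<..<1} - S.
        ((\<lambda>t. F (x + t *\<^sub>R e)) has_real_derivative F' (x + t *\<^sub>R e)) (at t))"
  shows "(\<integral>x. F' x \<partial>lborel) = 0"
proof -
  have [measurable]: "F \<in> borel_measurable borel" "F' \<in> borel_measurable borel"
    using F F' by auto
  have translate: "(\<integral>x. f (x + c) \<partial>lborel) = (\<integral>x. f x \<partial>lborel)" "integrable lborel f \<Longrightarrow> integrable lborel (\<lambda>x. f (x + c))"
    if [measurable]: "f \<in> borel_measurable borel" for f :: "R3 \<Rightarrow> real" and c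
    using integral_distr[of "(+) c" lborel borel f] integrable_distr_eq[of "(+) c" lborel borel f]
    by (simp_all add: lborel_distr_plus add.commute)
  have nn_translate: "(\<integral>\<^sup>+x. f (x + c) \<partial>lborel) = (\<integral>\<^sup>+x. f x \<partial>lborel)"
    if [measurable]: "f \<in> borel_measurable borel" for f :: "R3 \<Rightarrow> ennreal" and c
    using nn_integral_distr[of "(+) c" lborel borel f] by (simp add: lborel_distr_plus add.commute)
  define Q where "Q x t = indicator {0..1} t * F' (x + t *\<^sub>R e)" for x and t :: real
  have line [measurable]: "(\<lambda>p. fst p + snd p *\<^sub>R e) \<in> borel_measurable (borel \<Otimes>\<^sub>M borel)"
    by measurable
  have Qm [measurable]: "(\<lambda>(x, t). Q x t) \<in> borel_measurable (borel \<Otimes>\<^sub>M borel)"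
    unfolding Q_def case_prod_beta' by measurable
  have Q: "integrable (lborel \<Otimes>\<^sub>M lborel) (\<lambda>(x, t). Q x t)"
    unfolding integrable_iff_bounded
  proof
    have "(\<integral>\<^sup>+p. ennreal (norm (case p of (x, t) \<Rightarrow> Q x t)) \<partial>(lborel \<Otimes>\<^sub>M lborel))
      = (\<integral>\<^sup>+t. \<integral>\<^sup>+x. ennreal \<bar>Q x t\<bar> \<partial>lborel \<partial>lborel)"
      by (subst lborel_pair.nn_integral_snd[symmetric]) auto
    also have "\<dots> = (\<integral>\<^sup>+t. indicator {0..1::real} t * (\<integral>\<^sup>+x. ennreal \<bar>F' x\<bar> \<partial>lborel) \<partial>lborel)"
    proof (rule nn_integral_cong)
      fix t :: real
      show "(\<integral>\<^sup>+x. ennreal \<bar>Q x t\<bar> \<partial>lborel) = indicator {0..1} t * (\<integral>\<^sup>+x. ennreal \<bar>F' x\<bar> \<partial>lborel)"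
        using nn_translate[of "\<lambda>x. ennreal \<bar>F' x\<bar>" "t *\<^sub>R e"] by (simp add: Q_def split: split_indicator)
    qed
    also have "\<dots> = (\<integral>\<^sup>+x. ennreal \<bar>F' x\<bar> \<partial>lborel)"
      by (subst nn_integral_multc) auto
    also have "\<dots> < \<infinity>" using F' by (simp add: integrable_iff_bounded)
    finally show "(\<integral>\<^sup>+p. ennreal (norm (case p of (x, t) \<Rightarrow> Q x t)) \<partial>(lborel \<Otimes>\<^sub>M lborel)) < \<infinity>" .
  qed (simp add: Qm)
  have "(\<integral>x. F' x \<partial>lborel) = (\<integral>t. indicator {0..1} t * (\<integral>x. F' x \<partial>lborel) \<partial>(lborel :: real measure))"
    by simp
  also have "\<dots> = (\<integral>t. \<integral>x. Q x t \<partial>lborel \<partial>lborel)"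
    using translate[of F'] by (intro Bochner_Integration.integral_cong) (auto simp: Q_def)
  also have "\<dots> = (\<integral>x. \<integral>t. Q x t \<partial>lborel \<partial>lborel)"
    by (rule lborel_pair.Fubini_integral[OF Q])
  also have "\<dots> = (\<integral>x. F (x + e) - F x \<partial>lborel)"
  proof (rule integral_cong_AE)
    show "AE x in lborel. (\<integral>t. Q x t \<partial>lborel) = F (x + e) - F x"
      using lborel_pair.AE_integrable_fst[OF Q]
    proof eventually_elim
      fix x assume "integrable lborel (Q x)"
      \<comment> \<open>The fundamental theorem below yields a gauge integral; integrability of
        \<open>Q x\<close>, known for almost every x, identifies it with the Lebesgue
        integral.\<close>
      then have 1: "(Q x has_integral (\<integral>t. Q x t \<partial>lborel)) UNIV"
        by (rule has_integral_integral_lborel)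
      obtain S where S: "finite S" "\<And>t. t \<in> {0<..<1} - S \<Longrightarrow>
        ((\<lambda>t. F (x + t *\<^sub>R e)) has_real_derivative F' (x + t *\<^sub>R e)) (at t)"
        using deriv[of x] by blast
      have "((\<lambda>t. F' (x + t *\<^sub>R e)) has_integral (F (x + 1 *\<^sub>R e) - F (x + 0 *\<^sub>R e))) {0..1}"
        using S cont by (intro fundamental_theorem_of_calculus_interior_strong[of S])
          (auto simp flip: has_real_derivative_iff_has_vector_derivative)
      then have "((\<lambda>t. if t \<in> {0..1} then F' (x + t *\<^sub>R e) else 0) has_integral (F (x + e) - F x)) UNIV"
        by (subst has_integral_restrict_UNIV) simp
      also have "(\<lambda>t. if t \<in> {0..1} then F' (x + t *\<^sub>R e) else 0) = Q x"
        by (auto simp: Q_def)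
      finally show "(\<integral>t. Q x t \<partial>lborel) = F (x + e) - F x"
        using 1 has_integral_unique by blast
    qed
  qed (use Qm in measurable)
  also have "\<dots> = 0"
    using translate[of F e] F by (subst Bochner_Integration.integral_diff) auto
  finally show ?thesis .
qed

lemma integrable_continuous_compact_support:
  fixes f :: "R3 \<Rightarrow> 'b::{banach,second_countable_topology}"
  assumes "compact K" "continuous_on UNIV f" "\<And>x. x \<notin> K \<Longrightarrow> f x = 0"
  shows "integrable lborel f"
proof -
  have "integrable lborel (\<lambda>x. indicator K x *\<^sub>R f x)"
    using assms by (intro borel_integrable_compact) (auto intro: continuous_on_subset)
  also have "(\<lambda>x. indicator K x *\<^sub>R f x) = f"
    using assms(3) by (auto split: split_indicator)
  finally show ?thesis .
qed

lemma partial_deriv_line: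
  assumes "f differentiable_on UNIV"
  shows "((\<lambda>t. f (x + t *\<^sub>R axis i 1)) has_real_derivative partial_deriv i f (x + t *\<^sub>R axis i 1)) (at t)"
proof -
  have "(f has_derivative frechet_derivative f (at (x + t *\<^sub>R axis i 1))) (at (x + t *\<^sub>R axis i 1))"
    using assms by (simp add: differentiable_on_def frechet_derivative_works)
  then have "(f \<circ> (\<lambda>t. x + t *\<^sub>R axis i 1) has_derivative frechet_derivative f (at (x + t *\<^sub>R axis i 1)) \<circ> (\<lambda>t. t *\<^sub>R axis i 1)) (at t)"
    by (intro diff_chain_at) (auto intro!: derivative_eq_intros)
  moreover have "linear (frechet_derivative f (at (x + t *\<^sub>R axis i 1)))"
    using assms by (simp add: differentiable_on_def linear_frechet_derivative)
  ultimately show ?thesis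
    unfolding has_field_derivative_def
    by (simp add: comp_def partial_deriv_def linear_cmul mult.commute[of _ "frechet_derivative _ _ _"])
qed

lemma partial_deriv_eq_0_outside:
  assumes "closed K" "\<And>x. x \<notin> K \<Longrightarrow> f x = 0" "x \<notin> K"
  shows "partial_deriv i f x = 0"
proof -
  have "((\<lambda>_. 0) has_derivative (\<lambda>_. 0)) (at x)" by simp
  then have "(f has_derivative (\<lambda>_. 0)) (at x)"
    by (rule has_derivative_transform_within_open[of _ _ _ _ "- K"]) (use assms in auto)
  then show ?thesis
    by (simp add: partial_deriv_def frechet_derivative_at[symmetric])
qed

section \<open>Integrals over a sphere\<close>

text \<open>Throughout this section the expression is |x - y|^2 for |x| = R, |y| = r and height u of
  y along x. The condition \<open>r \<noteq> R\<close> keeps the sphere away from x.\<close>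

lemma axial_distance_pos:
  fixes R r u :: real
  assumes "R > 0" "r \<ge> 0" "r \<noteq> R" "\<bar>u\<bar> \<le> r"
  shows "R\<^sup>2 - 2 * R * u + r\<^sup>2 > 0"
proof -
  have "R * u \<le> R * r" using assms by auto
  then have "R\<^sup>2 - 2 * R * u + r\<^sup>2 \<ge> (R - r)\<^sup>2" by (simp add: power2_eq_square algebra_simps)
  moreover have "(R - r)\<^sup>2 > 0" using assms by simp
  ultimately show ?thesis by linarith
qed

lemma axial_distance_ends:
  fixes R r :: real
  assumes "R > 0" "r \<ge> 0"
  shows "sqrt (R\<^sup>2 - 2 * R * r + r\<^sup>2) = \<bar>R - r\<bar>" "sqrt (R\<^sup>2 - 2 * R * (- r) + r\<^sup>2) = R + r"
proof -
  have "R\<^sup>2 - 2 * R * r + r\<^sup>2 = (R - r)\<^sup>2" "R\<^sup>2 - 2 * R * (- r) + r\<^sup>2 = (R + r)\<^sup>2"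
    by (simp_all add: power2_eq_square algebra_simps)
  then show "sqrt (R\<^sup>2 - 2 * R * r + r\<^sup>2) = \<bar>R - r\<bar>" "sqrt (R\<^sup>2 - 2 * R * (- r) + r\<^sup>2) = R + r"
    using assms by simp_all
qed

lemma DERIV_axial_distance:
  fixes R r u :: real
  assumes "R\<^sup>2 - 2 * R * u + r\<^sup>2 > 0"
  shows "((\<lambda>u. sqrt (R\<^sup>2 - 2 * R * u + r\<^sup>2)) has_real_derivative - R / sqrt (R\<^sup>2 - 2 * R * u + r\<^sup>2)) (at u)"
  using assms by (auto intro!: derivative_eq_intros simp: field_simps)

text \<open>The common shape of the antiderivatives in the force and flux integrals, with
  \<open>d\<close> the distance to x.\<close>

lemma DERIV_reciprocal_plus:
  fixes d :: "real \<Rightarrow> real"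
  assumes "(d has_real_derivative d') (at u)" "d u \<noteq> 0"
  shows "((\<lambda>u. (a / d u + b * d u) / c) has_real_derivative (- a * d' / (d u)\<^sup>2 + b * d') / c) (at u)"
  using assms by (cases "c = 0") (auto intro!: derivative_eq_intros simp: power2_eq_square)

text \<open>End values of those antiderivatives at \<open>u = r\<close> and \<open>u = - r\<close>.
  The sign of R - r in the first is what separates spheres inside |x| from spheres outside.\<close>

lemma axial_quotients:
  fixes R r :: real
  assumes "0 < R" "0 \<le> r" "r \<noteq> R"
 shows "(R\<^sup>2 - r\<^sup>2) / \<bar>R - r\<bar> = (if r < R then R + r else - (R + r))" "(R\<^sup>2 - r\<^sup>2) / (R + r) = R - r"
proof -
  have sq: "R\<^sup>2 - r\<^sup>2 = (R - r) * (R + r)" by (simp add: power2_eq_square algebra_simps)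
  show "(R\<^sup>2 - r\<^sup>2) / (R + r) = R - r" using assms unfolding sq by simp
  show "(R\<^sup>2 - r\<^sup>2) / \<bar>R - r\<bar> = (if r < R then R + r else - (R + r))"
  proof (cases "r < R")
    case True
    then have "\<bar>R - r\<bar> = R - r" by simp
    then show ?thesis unfolding sq using True by simp
  next
    case False
    then have a: "\<bar>R - r\<bar> = - (R - r)" by simp
    have "(R - r) * (R + r) / - (R - r) = - ((R - r) * (R + r) / (R - r))" by (rule minus_divide_right[symmetric])
    also have "\<dots> = - (R + r)" using assms(3) by simp
    finally show ?thesis unfolding sq a using False by simp
  qed
qed
text \<open>With d the distance, d' = - R / d, so - d / R is an antiderivative; its end values
  involve only |R - r| and R + r.\<close>

lemma integral_axial_potential:
  fixes R r :: real
  assumes "R > 0" "r \<ge> 0" "r \<noteq> R"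
  shows "(\<integral>u. (1 / sqrt (R\<^sup>2 - 2 * R * u + r\<^sup>2)) * indicator {- r..r} u \<partial>lborel) = 2 * min R r / R"
proof -
  let ?d = "\<lambda>u. sqrt (R\<^sup>2 - 2 * R * u + r\<^sup>2)"
  have pos: "?d u > 0" "R\<^sup>2 - 2 * R * u + r\<^sup>2 > 0" if "- r \<le> u" "u \<le> r" for u
    using axial_distance_pos[OF assms, of u] that by auto
  have "(\<integral>u. (1 / ?d u) * indicator {- r..r} u \<partial>lborel) = (- ?d r / R) - (- ?d (- r) / R)"
  proof (rule integral_FTC_Icc_real)
    fix u assume u: "- r \<le> u" "u \<le> r"
    show "((\<lambda>u. - ?d u / R) has_real_derivative 1 / ?d u) (at u)"
      using DERIV_cdivide[OF DERIV_minus[OF DERIV_axial_distance[OF pos(2)[OF u]]], of R] assms(1) by simp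
    show "isCont (\<lambda>u. 1 / ?d u) u"
      using pos(1)[OF u] by (intro continuous_intros) simp
  qed (use assms in auto)
  also have "\<dots> = 2 * min R r / R"
    using assms unfolding axial_distance_ends[OF assms(1,2)] by (auto simp: min_def field_simps)
  finally show ?thesis .
qed

text \<open>Newton's theorem for a single sphere. From 2 R (R - u) = (R^2 - r^2) + d^2 the integrand
  is a combination of 1/d^3 and 1/d, whose antiderivatives are multiples of 1/d and d.\<close>

lemma integral_axial_force:
  fixes R r :: real
  assumes "R > 0" "r \<ge> 0" "r \<noteq> R"
  shows "(\<integral>u. ((R - u) / sqrt (R\<^sup>2 - 2 * R * u + r\<^sup>2) ^ 3) * indicator {- r..r} u \<partial>lborel)
    = (if r < R then 2 * r / R\<^sup>2 else 0)"
proof -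
  let ?d = "\<lambda>u. sqrt (R\<^sup>2 - 2 * R * u + r\<^sup>2)"
  let ?F = "\<lambda>u. ((R\<^sup>2 - r\<^sup>2) / ?d u + - 1 * ?d u) / (2 * R\<^sup>2)"
  have pos: "?d u > 0" "R\<^sup>2 - 2 * R * u + r\<^sup>2 > 0" if "- r \<le> u" "u \<le> r" for u
    using axial_distance_pos[OF assms, of u] that by auto
  have "(\<integral>u. ((R - u) / ?d u ^ 3) * indicator {- r..r} u \<partial>lborel) = ?F r - ?F (- r)"
  proof (rule integral_FTC_Icc_real)
    fix u assume u: "- r \<le> u" "u \<le> r"
    note [simp] = pos[OF u] less_imp_neq[OF pos(1)[OF u], symmetric] less_imp_neq[OF pos(2)[OF u], symmetric]
    have d: "(?d has_real_derivative - R / ?d u) (at u)"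
      using u pos by (intro DERIV_axial_distance)
    have alg: "(- a * (- R / w) / w\<^sup>2 + - 1 * (- R / w)) / (2 * R\<^sup>2) = (R * a + R * w\<^sup>2) / (2 * R\<^sup>2 * w ^ 3)"
      if "w > 0" for a w :: real
      using assms(1) that by (simp add: field_simps power2_eq_square power3_eq_cube)
    have sq: "(?d u)\<^sup>2 = R\<^sup>2 - 2 * R * u + r\<^sup>2"
      by (rule real_sqrt_pow2[OF less_imp_le[OF pos(2)[OF u]]])
    have "(?F has_real_derivative (- (R\<^sup>2 - r\<^sup>2) * (- R / ?d u) / (?d u)\<^sup>2 + - 1 * (- R / ?d u)) / (2 * R\<^sup>2)) (at u)"
      using pos(1)[OF u] by (intro DERIV_reciprocal_plus d) simp
    also have "(- (R\<^sup>2 - r\<^sup>2) * (- R / ?d u) / (?d u)\<^sup>2 + - 1 * (- R / ?d u)) / (2 * R\<^sup>2) = (R * (R\<^sup>2 - r\<^sup>2) + R * (?d u)\<^sup>2) / (2 * R\<^sup>2 * ?d u ^ 3)"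
      by (rule alg[OF pos(1)[OF u]])
    also have "\<dots> = (R - u) / ?d u ^ 3"
      unfolding sq using assms(1) by (simp add: divide_simps) (simp add: algebra_simps power2_eq_square)
    finally show "(?F has_real_derivative (R - u) / ?d u ^ 3) (at u)" .
    show "isCont (\<lambda>u. (R - u) / ?d u ^ 3) u"
      by (intro continuous_intros) simp
  qed (use assms in auto)
  also have "\<dots> = (if r < R then 2 * r / R\<^sup>2 else 0)"
    unfolding axial_distance_ends[OF assms(1,2)]
  proof (cases "r < R")
    case True
    then have quot: "(R\<^sup>2 - r\<^sup>2) / \<bar>R - r\<bar> = R + r" "(R\<^sup>2 - r\<^sup>2) / (R + r) = R - r"
      using axial_quotients[of R r] assms by simp_all
    have num: "(R + r) + - 1 * \<bar>R - r\<bar> = 2 * r" "(R - r) + - 1 * (R + r) = - (2 * r)"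
      using True by auto
    show "((R\<^sup>2 - r\<^sup>2) / \<bar>R - r\<bar> + - 1 * \<bar>R - r\<bar>) / (2 * R\<^sup>2) - ((R\<^sup>2 - r\<^sup>2) / (R + r) + - 1 * (R + r)) / (2 * R\<^sup>2)
      = (if r < R then 2 * r / R\<^sup>2 else 0)"
      unfolding quot num using True by simp
  next
    case False
    then have quot: "(R\<^sup>2 - r\<^sup>2) / \<bar>R - r\<bar> = - (R + r)" "(R\<^sup>2 - r\<^sup>2) / (R + r) = R - r"
      using axial_quotients[of R r] assms by simp_all
    have num: "- (R + r) + - 1 * \<bar>R - r\<bar> = - (2 * r)" "(R - r) + - 1 * (R + r) = - (2 * r)"
      using False by auto
    show "((R\<^sup>2 - r\<^sup>2) / \<bar>R - r\<bar> + - 1 * \<bar>R - r\<bar>) / (2 * R\<^sup>2) - ((R\<^sup>2 - r\<^sup>2) / (R + r) + - 1 * (R + r)) / (2 * R\<^sup>2)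
      = (if r < R then 2 * r / R\<^sup>2 else 0)"
      unfolding quot num using False by simp
  qed
  finally show ?thesis .
qed

text \<open>The integrand is y contracted with the kernel of the lambda potential, and 2 (R u - r^2)
  = (R^2 - r^2) - d^2 gives the antiderivative. The first summand integrates to 0 for r < R and to
  -2 for r > R; the normalising summand 1/r adds 2, so only spheres inside |x| remain.\<close>

lemma integral_axial_flux:
  fixes R r :: real
  assumes "R > 0" "r \<ge> 0" "r \<noteq> R"
  shows "(\<integral>u. ((R * u - r\<^sup>2) / sqrt (R\<^sup>2 - 2 * R * u + r\<^sup>2) ^ 3 + 1 / r) * indicator {- r..r} u \<partial>lborel)
    = (if 0 < r \<and> r < R then 2 else 0)"
proof (cases "r = 0")
  case True
  \<comment> \<open>The interval is the point 0, where the integrand vanishes because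
    \<open>1 / 0 = 0\<close>.\<close>
  have "(\<integral>u. ((R * u - r\<^sup>2) / sqrt (R\<^sup>2 - 2 * R * u + r\<^sup>2) ^ 3 + 1 / r) * indicator {- r..r} u \<partial>lborel) = (\<integral>(u::real). 0 \<partial>lborel)"
    using True by (intro Bochner_Integration.integral_cong) (auto split: split_indicator)
  then show ?thesis using True by simp
next
  case False
  let ?d = "\<lambda>u. sqrt (R\<^sup>2 - 2 * R * u + r\<^sup>2)"
  let ?F = "\<lambda>u. ((R\<^sup>2 - r\<^sup>2) / ?d u + 1 * ?d u) / (2 * R) + u / r"
  have pos: "?d u > 0" "R\<^sup>2 - 2 * R * u + r\<^sup>2 > 0" if "- r \<le> u" "u \<le> r" for u
    using axial_distance_pos[OF assms, of u] that by auto
  have "(\<integral>u. ((R * u - r\<^sup>2) / ?d u ^ 3 + 1 / r) * indicator {- r..r} u \<partial>lborel) = ?F r - ?F (- r)"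
  proof (rule integral_FTC_Icc_real)
    fix u assume u: "- r \<le> u" "u \<le> r"
    note [simp] = pos[OF u] less_imp_neq[OF pos(1)[OF u], symmetric] less_imp_neq[OF pos(2)[OF u], symmetric]
    have d: "(?d has_real_derivative - R / ?d u) (at u)"
      using u pos by (intro DERIV_axial_distance)
    have alg: "(- a * (- R / w) / w\<^sup>2 + 1 * (- R / w)) / (2 * R) = (R * a - R * w\<^sup>2) / (2 * R * w ^ 3)"
      if "w > 0" for a w :: real
      using assms(1) that by (simp add: field_simps power2_eq_square power3_eq_cube)
    have sq: "(?d u)\<^sup>2 = R\<^sup>2 - 2 * R * u + r\<^sup>2"
      by (rule real_sqrt_pow2[OF less_imp_le[OF pos(2)[OF u]]])
    have "(?F has_real_derivative (- (R\<^sup>2 - r\<^sup>2) * (- R / ?d u) / (?d u)\<^sup>2 + 1 * (- R / ?d u)) / (2 * R) + 1 / r) (at u)"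
      using pos(1)[OF u] by (intro DERIV_add DERIV_reciprocal_plus d DERIV_cdivide DERIV_ident) simp
    also have "(- (R\<^sup>2 - r\<^sup>2) * (- R / ?d u) / (?d u)\<^sup>2 + 1 * (- R / ?d u)) / (2 * R) = (R * (R\<^sup>2 - r\<^sup>2) - R * (?d u)\<^sup>2) / (2 * R * ?d u ^ 3)"
      by (rule alg[OF pos(1)[OF u]])
    also have "\<dots> = (R * u - r\<^sup>2) / ?d u ^ 3"
      unfolding sq using assms(1) by (simp add: divide_simps) (simp add: algebra_simps power2_eq_square)
    finally show "(?F has_real_derivative (R * u - r\<^sup>2) / ?d u ^ 3 + 1 / r) (at u)" .
    show "isCont (\<lambda>u. (R * u - r\<^sup>2) / ?d u ^ 3 + 1 / r) u"
      by (intro continuous_intros) simp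
  qed (use assms in auto)
  also have "\<dots> = (if 0 < r \<and> r < R then 2 else 0)"
    unfolding axial_distance_ends[OF assms(1,2)]
  proof (cases "r < R")
    case True
    then have quot: "(R\<^sup>2 - r\<^sup>2) / \<bar>R - r\<bar> = R + r" "(R\<^sup>2 - r\<^sup>2) / (R + r) = R - r"
      using axial_quotients[of R r] assms by simp_all
    have num: "(R + r) + 1 * \<bar>R - r\<bar> = 2 * R" "(R - r) + 1 * (R + r) = 2 * R"
      using True by auto
    show "((R\<^sup>2 - r\<^sup>2) / \<bar>R - r\<bar> + 1 * \<bar>R - r\<bar>) / (2 * R) + r / r - (((R\<^sup>2 - r\<^sup>2) / (R + r) + 1 * (R + r)) / (2 * R) + - r / r)
      = (if 0 < r \<and> r < R then 2 else 0)"
      unfolding quot num using True False assms by simp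
  next
    case F: False
    then have quot: "(R\<^sup>2 - r\<^sup>2) / \<bar>R - r\<bar> = - (R + r)" "(R\<^sup>2 - r\<^sup>2) / (R + r) = R - r"
      using axial_quotients[of R r] assms by simp_all
    have num: "- (R + r) + 1 * \<bar>R - r\<bar> = - (2 * R)" "(R - r) + 1 * (R + r) = 2 * R"
      using F by auto
    show "((R\<^sup>2 - r\<^sup>2) / \<bar>R - r\<bar> + 1 * \<bar>R - r\<bar>) / (2 * R) + r / r - (((R\<^sup>2 - r\<^sup>2) / (R + r) + 1 * (R + r)) / (2 * R) + - r / r)
      = (if 0 < r \<and> r < R then 2 else 0)"
      unfolding quot num using F False assms by simp
  qed
  finally show ?thesis .
qed

section \<open>The potentials of the shell\<close>

definition shell_mass :: "real \<Rightarrow> real" where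
  "shell_mass s = max 0 (min 1 (s - 1))"

definition shell_profile :: "real \<Rightarrow> real" where
  "shell_profile s = indicator {1..2} s / (2 * pi * sqrt s)"

definition shell_density :: "R3 \<Rightarrow> real" where
  "shell_density y = shell_profile (y \<bullet> y)"

text \<open>The factor of x in the Newtonian gradient. As the mass vanishes for
  \<open>s \<le> 1\<close>, writing \<open>max 1 s\<close> for s leaves the values unchanged and
  makes continuity at 0 evident; the same holds for \<open>lambda_field\<close>, and
  \<open>fields_eq\<close> restores the natural form.\<close>

definition newton_field :: "real \<Rightarrow> real" where
  "newton_field s = shell_mass s / sqrt (max 1 s) ^ 3"

definition lambda_field :: "real \<Rightarrow> real" where
  "lambda_field s = sqrt (shell_mass s) / max 1 s"

lemma continuous_on_fields [continuous_intros]: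
  "continuous_on S newton_field" "continuous_on S lambda_field"
proof -
  have [simp]: "max 1 s \<noteq> 0" for s :: real by (simp add: max_def)
  show "continuous_on S newton_field" "continuous_on S lambda_field"
    unfolding newton_field_def[abs_def] lambda_field_def[abs_def] shell_mass_def[abs_def]
    by (intro continuous_intros; simp)+
qed

lemma measurable_shell [measurable]:
  "shell_profile \<in> borel_measurable borel" "shell_density \<in> borel_measurable borel"
  "newton_field \<in> borel_measurable borel" "lambda_field \<in> borel_measurable borel"
proof -
  show [measurable]: "shell_profile \<in> borel_measurable borel"
    unfolding shell_profile_def by measurable
  show "shell_density \<in> borel_measurable borel"
    unfolding shell_density_def by measurable
  show "newton_field \<in> borel_measurable borel" "lambda_field \<in> borel_measurable borel"
    by (intro borel_measurable_continuous_onI continuous_on_fields)+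
qed

lemma shell_profile_bounds: "0 \<le> shell_profile s" "shell_profile s \<le> 1"
proof -
  have "1 \<le> 2 * pi * sqrt s" if "s \<ge> 1"
    using mult_mono[of 1 "2 * pi" 1 "sqrt s"] that pi_ge_two by simp
  then show "0 \<le> shell_profile s" "shell_profile s \<le> 1"
    by (auto simp: shell_profile_def indicator_def)
qed

lemma fields_eq: 
  "newton_field s = shell_mass s / sqrt s ^ 3" "lambda_field s = sqrt (shell_mass s) / s"
  by (auto simp: newton_field_def lambda_field_def shell_mass_def max_def)

section \<open>Distances in axial coordinates and integrability of the Newtonian kernels\<close>

lemma norm_diff_axial:
  fixes x y :: R3
  assumes "x \<noteq> 0"
  shows "norm (x - y) = sqrt ((norm x)\<^sup>2 - 2 * norm x * (y \<bullet> (x /\<^sub>R norm x)) + y \<bullet> y)"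
  using assms by (simp add: norm_eq_sqrt_inner[of "x - y"] inner_diff_left inner_diff_right inner_commute[of y x]
      power2_norm_eq_inner)

lemma integrable_translated_kernel:
  fixes x :: R3
  shows "integrable lborel (\<lambda>y. indicator {..L} ((x - y) \<bullet> (x - y)) / ((x - y) \<bullet> (x - y)))"
proof -
  let ?f = "\<lambda>y::R3. indicator {..L} (y \<bullet> y) / (y \<bullet> y)"
  have *: "(y - x) \<bullet> (y - x) = (x - y) \<bullet> (x - y)" for y
    by (simp add: inner_diff_left inner_diff_right inner_commute)
  have "integrable (distr lborel borel ((+) (- x))) ?f"
    using integrable_inverse_square_ball[of L] by (simp add: lborel_distr_plus)
  then show ?thesis
    by (subst (asm) integrable_distr_eq) (auto simp: *)
qed

lemma norm_le_2_of_shell_density: "shell_density y \<noteq> 0 \<Longrightarrow> norm y \<le> 2"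
proof -
  assume "shell_density y \<noteq> 0"
  then have "y \<bullet> y \<le> 2\<^sup>2" by (auto simp: shell_density_def shell_profile_def indicator_def split: if_splits)
  then show "norm y \<le> 2"
    by (metis norm_le_square zero_le_numeral power2_norm_eq_inner power2_le_imp_le)
qed

lemma integrable_gradient_kernel:
  "integrable lborel (\<lambda>y. shell_density y *\<^sub>R ((x - y) /\<^sub>R norm (x - y) ^ 3))"
\<comment> \<open>The shell lies in the ball of radius 2 about 0, hence in the ball of radius
  \<open>norm x + 2\<close> about x, where 1/|x - y|^2 is a majorant.\<close>
proof (rule Bochner_Integration.integrable_bound[OF integrable_translated_kernel[of "(norm x + 2)\<^sup>2" x]])
  show "AE y in lborel. norm (shell_density y *\<^sub>R ((x - y) /\<^sub>R norm (x - y) ^ 3))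
    \<le> norm (indicator {..(norm x + 2)\<^sup>2} ((x - y) \<bullet> (x - y)) / ((x - y) \<bullet> (x - y)) :: real)"
  proof (rule AE_I2)
    fix y
    show "norm (shell_density y *\<^sub>R ((x - y) /\<^sub>R norm (x - y) ^ 3))
      \<le> norm (indicator {..(norm x + 2)\<^sup>2} ((x - y) \<bullet> (x - y)) / ((x - y) \<bullet> (x - y)) :: real)"
    proof (cases "shell_density y = 0")
      case False
      then have "norm (x - y) \<le> norm x + 2"
        using norm_le_2_of_shell_density[of y] norm_triangle_ineq4[of x y] by linarith
      then have *: "indicator {..(norm x + 2)\<^sup>2} ((x - y) \<bullet> (x - y)) = (1::real)"
        by (simp add: power2_norm_eq_inner[symmetric] power_mono)
      have "\<bar>shell_density y\<bar> \<le> 1"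
        using shell_profile_bounds[of "y \<bullet> y"] by (simp add: shell_density_def)
      then have "\<bar>shell_density y\<bar> * (inverse (norm (x - y) ^ 3) * norm (x - y)) \<le> 1 * (inverse (norm (x - y) ^ 3) * norm (x - y))"
        by (intro mult_right_mono) auto
      also have "\<dots> = 1 / (norm (x - y))\<^sup>2"
        by (simp add: power2_eq_square power3_eq_cube field_simps)
      finally show ?thesis
        unfolding * by (simp add: power2_norm_eq_inner abs_mult mult.assoc)
    qed simp
  qed
qed simp

lemma integrable_potential_kernel:
  "integrable lborel (\<lambda>y. shell_density y / norm (x - y))"
\<comment> \<open>The factor \<open>norm x + 2\<close> bounds |x - y| on the shell and so turns 1/|x
  - y| into the majorant 1/|x - y|^2 already available.\<close>
proof (rule Bochner_Integration.integrable_bound[OF integrable_mult_right[OF integrable_translated_kernel[of "(norm x + 2)\<^sup>2" x], of "norm x + 2"]])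
  show "AE y in lborel. norm (shell_density y / norm (x - y))
    \<le> norm ((norm x + 2) * (indicator {..(norm x + 2)\<^sup>2} ((x - y) \<bullet> (x - y)) / ((x - y) \<bullet> (x - y))))"
  proof (rule AE_I2)
    fix y
    show "norm (shell_density y / norm (x - y))
      \<le> norm ((norm x + 2) * (indicator {..(norm x + 2)\<^sup>2} ((x - y) \<bullet> (x - y)) / ((x - y) \<bullet> (x - y))))"
    proof (cases "shell_density y = 0 \<or> x = y")
      case False
      then have le: "norm (x - y) \<le> norm x + 2"
        using norm_le_2_of_shell_density[of y] norm_triangle_ineq4[of x y] by linarith
      then have *: "indicator {..(norm x + 2)\<^sup>2} ((x - y) \<bullet> (x - y)) = (1::real)"
        by (simp add: power2_norm_eq_inner[symmetric] power_mono)
      have "\<bar>shell_density y\<bar> \<le> 1"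
        using shell_profile_bounds[of "y \<bullet> y"] by (simp add: shell_density_def)
      then have "\<bar>shell_density y\<bar> / norm (x - y) \<le> 1 / norm (x - y)"
        by (intro divide_right_mono) auto
      also have "\<dots> \<le> (norm x + 2) * (1 / (norm (x - y))\<^sup>2)"
        using le False by (simp add: field_simps power2_eq_square)
      finally show ?thesis
        unfolding * by (simp add: power2_norm_eq_inner abs_mult)
    qed auto
  qed
qed simp

section \<open>The Newtonian gradient of the shell\<close>

lemma AE_lborel_sqrt_neq: "AE s in lborel. sqrt s \<noteq> (R :: real)"
proof -
  \<comment> \<open>\<open>sqrt\<close> is odd, so for negative \<open>R\<close> the value to
    exclude is \<open>- (R\<^sup>2)\<close>.\<close>
  have "AE s in lborel. s \<noteq> R\<^sup>2 \<and> s \<noteq> - (R\<^sup>2)"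
    by (intro AE_conjI AE_lborel_singleton)
  then show ?thesis
  proof eventually_elim
    fix s :: real assume s: "s \<noteq> R\<^sup>2 \<and> s \<noteq> - (R\<^sup>2)"
    have "(sqrt s)\<^sup>2 = \<bar>s\<bar>"
      by (simp add: real_sqrt_abs2 power2_eq_square flip: real_sqrt_mult)
    with s show "sqrt s \<noteq> R" by (auto simp: abs_if split: if_splits)
  qed
qed

lemma newton_gradient_inner:
  fixes x :: R3
  assumes x: "x \<noteq> 0"
  defines "R \<equiv> norm x" and "e \<equiv> x /\<^sub>R norm x"
  shows "newton_gradient shell_density x \<bullet> e = shell_mass (x \<bullet> x) / (x \<bullet> x)"
proof -
  have R: "R > 0" "R \<noteq> 0" and e: "norm e = 1" using x by (auto simp: R_def e_def)
  have xe: "x \<bullet> e = R" using x by (simp add: e_def R_def power2_norm_eq_inner[symmetric] power2_eq_square field_simps)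
  have xx: "x \<bullet> x = R\<^sup>2" by (simp add: R_def power2_norm_eq_inner)
  define F :: "real \<times> real \<Rightarrow> real" where
    "F = (\<lambda>(u, s). shell_profile s * ((R - u) / sqrt (R\<^sup>2 - 2 * R * u + s) ^ 3))"
  \<comment> \<open>On the shell \<open>shell_profile s * (2 * sqrt s) = 1 / pi\<close>, so all
    spheres with \<open>s < R\<^sup>2\<close> contribute equally and the enclosed mass becomes the
    length of an interval.\<close>
  define G where "G s = indicator ({1..2} \<inter> {..<R\<^sup>2}) s / (pi * R\<^sup>2)" for s
  have dist: "norm (x - y) = sqrt (R\<^sup>2 - 2 * R * (y \<bullet> e) + y \<bullet> y)" for y
    unfolding R_def e_def by (rule norm_diff_axial[OF x])
  have eq: "(shell_density y *\<^sub>R ((x - y) /\<^sub>R norm (x - y) ^ 3)) \<bullet> e = F (y \<bullet> e, y \<bullet> y)" for y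
    by (simp add: F_def shell_density_def inner_diff_left xe divide_inverse dist)
  have "newton_gradient shell_density x \<bullet> e
    = (\<integral>y. (shell_density y *\<^sub>R ((x - y) /\<^sub>R norm (x - y) ^ 3)) \<bullet> e \<partial>lborel)"
    unfolding newton_gradient_def using integrable_gradient_kernel by (intro integral_inner_left[symmetric])
  also have "\<dots> = (\<integral>y. F (y \<bullet> e, y \<bullet> y) \<partial>lborel)"
    by (simp only: eq)
  also have "\<dots> = pi * (\<integral>s. G s \<partial>lborel)"
  proof (rule integral_axial[OF e])
    show "F \<in> borel_measurable (borel \<Otimes>\<^sub>M borel)" unfolding F_def by measurable
    show "G \<in> borel_measurable borel" unfolding G_def by measurable
    show "integrable lborel (\<lambda>y. F (y \<bullet> e, y \<bullet> y))"
      unfolding eq[symmetric] using integrable_gradient_kernel by (rule integrable_inner_left)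
    show "AE s in lborel. (\<integral>u. F (u, s) * indicator {- sqrt s..sqrt s} u \<partial>lborel) = G s"
      using AE_lborel_sqrt_neq[of R]
    proof eventually_elim
      fix s assume s: "sqrt s \<noteq> R"
      show "(\<integral>u. F (u, s) * indicator {- sqrt s..sqrt s} u \<partial>lborel) = G s"
      proof (cases "s \<in> {1..2}")
        case True
        have less: "sqrt s < R \<longleftrightarrow> s < R\<^sup>2"
          using real_sqrt_less_iff[of s "R\<^sup>2"] R by (simp del: real_sqrt_less_iff)
        have s2: "(sqrt s)\<^sup>2 = s" using True by simp
        have "(\<integral>u. F (u, s) * indicator {- sqrt s..sqrt s} u \<partial>lborel) = shell_profile s *
            (\<integral>u. ((R - u) / sqrt (R\<^sup>2 - 2 * R * u + (sqrt s)\<^sup>2) ^ 3) * indicator {- sqrt s..sqrt s} u \<partial>lborel)"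
          unfolding F_def prod.case mult.assoc integral_mult_right_zero s2 by (rule refl)
        also have "\<dots> = shell_profile s * (if sqrt s < R then 2 * sqrt s / R\<^sup>2 else 0)"
          using R s True by (subst integral_axial_force) auto
        also have "\<dots> = G s"
          using True R by (simp add: G_def less shell_profile_def indicator_def)
        finally show ?thesis .
      qed (auto simp: F_def G_def shell_profile_def)
    qed
  qed
  also have "(\<integral>s. G s \<partial>lborel) = measure lborel ({1..2} \<inter> {..<R\<^sup>2}) / (pi * R\<^sup>2)"
    unfolding G_def by simp
  also have "measure lborel ({1..2} \<inter> {..<R\<^sup>2}) = shell_mass (R\<^sup>2)"
  proof (cases "R\<^sup>2 \<le> 2")
    case True
    then have "{1..2} \<inter> {..<R\<^sup>2} = {1..<R\<^sup>2}" by auto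
    then show ?thesis using True by (simp add: shell_mass_def max_def)
  next
    case False
    then have "{1..2} \<inter> {..<R\<^sup>2} = {1..2}" by auto
    then show ?thesis using False by (simp add: shell_mass_def)
  qed
  finally show ?thesis by (simp add: xx)
qed

text \<open>The half turn \<open>A\<close> about the axis through x preserves x, Lebesgue measure
  and the density, so it fixes the gradient. Its fixed vectors are the multiples of
  \<open>e\<close>, and the radial component is already known.\<close>

lemma newton_gradient_shell:
  fixes x :: R3
  assumes x: "x \<noteq> 0"
  shows "newton_gradient shell_density x = newton_field (x \<bullet> x) *\<^sub>R x"
proof -
  define e where "e = x /\<^sub>R norm x"
  have ee: "e \<bullet> e = 1" using x by (simp add: e_def power2_norm_eq_inner[symmetric] power2_eq_square field_simps)
  have xe: "x = norm x *\<^sub>R e" using x by (simp add: e_def)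
  define A where "A y = (2 * (y \<bullet> e)) *\<^sub>R e - y" for y
  have lin: "linear A"
    by (rule linearI) (auto simp: A_def inner_add_left algebra_simps)
  then have bl: "bounded_linear A" by (rule linear_conv_bounded_linear[THEN iffD1])
  have ort: "orthogonal_transformation A"
    unfolding orthogonal_transformation_def
  proof (intro conjI allI lin)
    fix v w show "A v \<bullet> A w = v \<bullet> w"
      by (simp add: A_def inner_diff_left inner_diff_right inner_commute[of e w] ee algebra_simps)
  qed
  have norm_A: "norm (A y) = norm y" for y by (rule orthogonal_transformation_norm[OF ort])
  have "x \<bullet> e = norm x"
    using arg_cong[OF xe, of "\<lambda>z. z \<bullet> e"] by (simp add: ee)
  moreover have "(2 * norm x) *\<^sub>R e = x + x"
    using xe by (metis scaleR_2 scaleR_scaleR)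
  ultimately have Ax: "A x = x" by (simp add: A_def)
  let ?v = "\<lambda>y. shell_density y *\<^sub>R ((x - y) /\<^sub>R norm (x - y) ^ 3)"
  let ?N = "newton_gradient shell_density x"
  have [measurable]: "A \<in> borel_measurable borel"
    by (intro borel_measurable_continuous_onI linear_continuous_on bl)
  have vA: "?v (A y) = A (?v y)" for y
  proof -
    have "x - A y = A (x - y)" using linear_diff[OF lin, of x y] Ax by simp
    moreover have "shell_density (A y) = shell_density y"
      using norm_A[of y] by (simp add: shell_density_def power2_norm_eq_inner[symmetric])
    ultimately show ?thesis by (simp add: norm_A linear_cmul[OF lin])
  qed
  have "?N = (\<integral>y. ?v y \<partial>distr lborel borel A)"
    by (simp add: distr_lborel_orthogonal[OF ort] newton_gradient_def)
  also have "\<dots> = (\<integral>y. ?v (A y) \<partial>lborel)"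
    by (subst integral_distr) auto
  also have "\<dots> = A ?N"
    unfolding vA newton_gradient_def by (rule integral_bounded_linear[OF bl integrable_gradient_kernel])
  finally have "?N + ?N = (2 * (?N \<bullet> e)) *\<^sub>R e"
    by (simp add: A_def algebra_simps)
  then have "2 *\<^sub>R ?N = 2 *\<^sub>R ((?N \<bullet> e) *\<^sub>R e)"
    by (simp add: scaleR_2)
  then have "?N = (?N \<bullet> e) *\<^sub>R e"
    by (rule scaleR_left_imp_eq[of 2, rotated]) simp
  also have "?N \<bullet> e = shell_mass (x \<bullet> x) / (x \<bullet> x)"
    unfolding e_def by (rule newton_gradient_inner[OF x])
  also have "(shell_mass (x \<bullet> x) / (x \<bullet> x)) *\<^sub>R e = newton_field (x \<bullet> x) *\<^sub>R x"
    unfolding fields_eq e_def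
    by (simp add: norm_eq_sqrt_inner power3_eq_cube divide_inverse)
  finally show ?thesis .
qed

section \<open>The Newtonian potential of the shell\<close>

lemma lebesgue_integral_Icc_eq_integral:
  fixes f :: "real \<Rightarrow> real"
  assumes "continuous_on {a..b} f"
  shows "(\<integral>s. f s * indicator {a..b} s \<partial>lborel) = integral {a..b} f"
proof -
  have "set_integrable lborel {a..b} f"
    using borel_integrable_atLeastAtMost'[OF assms] .
  from set_borel_integral_eq_integral(2)[OF this] show ?thesis
    by (simp add: set_lebesgue_integral_def mult.commute)
qed

text \<open>The primitive of \<open>min (1 / sqrt s) (1 / sqrt t)\<close> in \<open>s\<close>.\<close>

definition primitive_min :: "real \<Rightarrow> real \<Rightarrow> real" where
  "primitive_min t s = min s t / sqrt t + 2 * sqrt (max s t) - 2 * sqrt t"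

lemma integral_min_inverse_sqrt:
  assumes "t > 0"
  shows "integral {1..2} (\<lambda>s. min (1 / sqrt s) (1 / sqrt t)) = primitive_min t 2 - primitive_min t 1"
proof (rule integral_unique, rule fundamental_theorem_of_calculus_interior_strong[of "{t}"])
  show "continuous_on {1..2} (primitive_min t)"
    using assms unfolding primitive_min_def by (intro continuous_intros) auto
  fix s assume s: "s \<in> {1<..<2} - {t}"
  show "(primitive_min t has_vector_derivative min (1 / sqrt s) (1 / sqrt t)) (at s)"
    unfolding has_real_derivative_iff_has_vector_derivative[symmetric]
  proof (cases "s < t")
    case True
    have "((\<lambda>s. s / sqrt t) has_real_derivative 1 / sqrt t) (at s)"
      by (rule DERIV_cdivide[OF DERIV_ident])
    moreover have "1 / sqrt s \<ge> 1 / sqrt t"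
      using True s by (intro divide_left_mono) auto
    then have "min (1 / sqrt s) (1 / sqrt t) = 1 / sqrt t" by simp
    moreover have "primitive_min t r = r / sqrt t" if "r < t" for r
      using that by (simp add: primitive_min_def)
    ultimately show "(primitive_min t has_real_derivative min (1 / sqrt s) (1 / sqrt t)) (at s)"
      using True by (auto intro: has_field_derivative_transform_within_open[where S = "{..<t}" and f = "\<lambda>s. s / sqrt t"])
  next
    case False
    then have st: "s > t" using s by auto
    have "((\<lambda>s. 2 * sqrt s - sqrt t) has_real_derivative 1 / sqrt s) (at s)"
      using s by (auto intro!: derivative_eq_intros simp: field_simps)
    moreover have "1 / sqrt s \<le> 1 / sqrt t"
      using st assms by (intro divide_left_mono) auto
    then have "min (1 / sqrt s) (1 / sqrt t) = 1 / sqrt s" by simp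
    moreover have "primitive_min t r = 2 * sqrt r - sqrt t" if "r > t" for r
      using that assms by (simp add: primitive_min_def real_div_sqrt)
    ultimately show "(primitive_min t has_real_derivative min (1 / sqrt s) (1 / sqrt t)) (at s)"
      using st by (auto intro: has_field_derivative_transform_within_open[where S = "{t<..}" and f = "\<lambda>s. 2 * sqrt s - sqrt t"])
  qed
qed auto

text \<open>As a function of t, the shell integral
  \<open>primitive_min t 2 - primitive_min t 1\<close> has derivative
  \<open>- newton_field t / 2\<close> away from the edges. For \<open>t \<le> 1\<close> it has the
  constant value \<open>2 * sqrt 2 - 2\<close>, which becomes the constant of integration.\<close>

lemma integral_newton_field:
  assumes "t > 0"
  shows "integral {0..t} newton_field = 2 * (2 * sqrt 2 - 2 - (primitive_min t 2 - primitive_min t 1))"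
proof (cases "t \<le> 1")
  case True
  then have "integral {0..t} newton_field = integral {0..t} (\<lambda>_. 0)"
    by (intro integral_cong) (auto simp: newton_field_def shell_mass_def)
  then show ?thesis using True assms by (simp add: primitive_min_def)
next
  case False
  let ?F = "\<lambda>t. - 2 * (primitive_min t 2 - primitive_min t 1)"
  have "(newton_field has_integral (?F t - ?F 1)) {1..t}"
  proof (rule fundamental_theorem_of_calculus_interior_strong[of "{2}"])
    show "continuous_on {1..t} ?F"
      unfolding primitive_min_def by (intro continuous_intros) auto
    fix s assume s: "s \<in> {1<..<t} - {2}"
    have pow: "sqrt s ^ 3 = s * sqrt s" using s by (simp add: power3_eq_cube)
    show "(?F has_vector_derivative newton_field s) (at s)"
      unfolding has_real_derivative_iff_has_vector_derivative[symmetric]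
    proof (cases "s < 2")
      case True
      have "((\<lambda>t. 2 / sqrt t - (4 * sqrt 2 - 2 * sqrt t)) has_real_derivative newton_field s) (at s)"
        using s True unfolding fields_eq pow shell_mass_def
        by (auto intro!: derivative_eq_intros simp: field_simps)
      then show "(?F has_real_derivative newton_field s) (at s)"
        using s True by (rule_tac has_field_derivative_transform_within_open[where S = "{1<..<2}"])
          (auto simp: primitive_min_def real_div_sqrt)
    next
      case False
      have "((\<lambda>t. - 2 / sqrt t) has_real_derivative newton_field s) (at s)"
        using s False unfolding fields_eq pow shell_mass_def
        by (auto intro!: derivative_eq_intros simp: field_simps)
      then show "(?F has_real_derivative newton_field s) (at s)"
        using s False by (rule_tac has_field_derivative_transform_within_open[where S = "{2<..}"])
          (auto simp: primitive_min_def field_simps)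
    qed
  qed (use False in auto)
  then have "integral {1..t} newton_field = ?F t - ?F 1"
    by (rule integral_unique)
  moreover have "integral {0..1} newton_field = integral {0..1::real} (\<lambda>_. 0)"
    by (intro integral_cong) (auto simp: newton_field_def shell_mass_def)
  then have "integral {0..1} newton_field = 0" by simp
  moreover have "integral {0..1} newton_field + integral {1..t} newton_field = integral {0..t} newton_field"
    by (rule Henstock_Kurzweil_Integration.integral_combine)
      (use False in \<open>auto intro: integrable_continuous_interval continuous_on_fields\<close>)
  moreover have "primitive_min 1 2 = 2 * sqrt 2 - 1" "primitive_min 1 1 = 1"
    by (simp_all add: primitive_min_def)
  ultimately show ?thesis by algebra
qed

text \<open>The potential is put in the form of a primitive of its field, so that adding the lambda
  part merely adds fields. The constant is the potential in the cavity, and the factor 1/2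
  compensates for the gradient 2 x of |x|^2.\<close>

lemma newton_potential_shell:
  fixes x :: R3
  assumes x: "x \<noteq> 0"
  shows "newton_potential shell_density x = 2 - 2 * sqrt 2 + integral {0..x \<bullet> x} newton_field / 2"
proof -
  define R and e where "R = norm x" and "e = x /\<^sub>R norm x"
  have R: "R > 0" "R \<noteq> 0" and e: "norm e = 1" using x by (auto simp: R_def e_def)
  have xx: "x \<bullet> x = R\<^sup>2" by (simp add: R_def power2_norm_eq_inner)
  define F :: "real \<times> real \<Rightarrow> real" where
    "F = (\<lambda>(u, s). shell_profile s * (1 / sqrt (R\<^sup>2 - 2 * R * u + s)))"
  \<comment> \<open>\<open>sqrt (R\<^sup>2)\<close> stands for \<open>R\<close> in order to match
    \<open>integral_min_inverse_sqrt\<close> with \<open>t = R\<^sup>2\<close>; for the same reason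
    \<open>real_sqrt_abs\<close> is removed when \<open>G\<close> is integrated.\<close>
  define G where "G s = min (1 / sqrt s) (1 / sqrt (R\<^sup>2)) * indicator {1..2} s / pi" for s
  have dist: "norm (x - y) = sqrt (R\<^sup>2 - 2 * R * (y \<bullet> e) + y \<bullet> y)" for y
    unfolding R_def e_def by (rule norm_diff_axial[OF x])
  have eq: "shell_density y / norm (x - y) = F (y \<bullet> e, y \<bullet> y)" for y
    by (simp add: F_def shell_density_def dist)
  have "newton_potential shell_density x = - (\<integral>y. F (y \<bullet> e, y \<bullet> y) \<partial>lborel)"
    unfolding newton_potential_def by (simp only: eq)
  also have "(\<integral>y. F (y \<bullet> e, y \<bullet> y) \<partial>lborel) = pi * (\<integral>s. G s \<partial>lborel)"
  proof (rule integral_axial[OF e])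
    show "F \<in> borel_measurable (borel \<Otimes>\<^sub>M borel)" unfolding F_def by measurable
    show "G \<in> borel_measurable borel" unfolding G_def by measurable
    show "integrable lborel (\<lambda>y. F (y \<bullet> e, y \<bullet> y))"
      unfolding eq[symmetric] by (rule integrable_potential_kernel)
    show "AE s in lborel. (\<integral>u. F (u, s) * indicator {- sqrt s..sqrt s} u \<partial>lborel) = G s"
      using AE_lborel_sqrt_neq[of R]
    proof eventually_elim
      fix s assume s: "sqrt s \<noteq> R"
      show "(\<integral>u. F (u, s) * indicator {- sqrt s..sqrt s} u \<partial>lborel) = G s"
      proof (cases "s \<in> {1..2}")
        case True
        have s2: "(sqrt s)\<^sup>2 = s" using True by simp
        have "(\<integral>u. F (u, s) * indicator {- sqrt s..sqrt s} u \<partial>lborel) = shell_profile s *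
            (\<integral>u. (1 / sqrt (R\<^sup>2 - 2 * R * u + (sqrt s)\<^sup>2)) * indicator {- sqrt s..sqrt s} u \<partial>lborel)"
          unfolding F_def prod.case mult.assoc integral_mult_right_zero s2 by (rule refl)
        also have "\<dots> = shell_profile s * (2 * min R (sqrt s) / R)"
          using R s True by (subst integral_axial_potential) auto
        also have "\<dots> = (min R (sqrt s) / (R * sqrt s)) / pi"
          using True R by (simp add: shell_profile_def)
        also have "min R (sqrt s) / (R * sqrt s) = min (1 / sqrt s) (1 / R)"
          using True R by (auto simp: min_def field_simps)
        finally show ?thesis using True R by (simp add: G_def)
      qed (simp add: F_def G_def shell_profile_def)
    qed
  qed
  also have "(\<integral>s. G s \<partial>lborel) = (primitive_min (R\<^sup>2) 2 - primitive_min (R\<^sup>2) 1) / pi"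
    unfolding G_def using R
    by (simp add: lebesgue_integral_Icc_eq_integral integral_min_inverse_sqrt continuous_intros
        del: real_sqrt_abs)
  finally have np: "newton_potential shell_density x = - (primitive_min (R\<^sup>2) 2 - primitive_min (R\<^sup>2) 1)"
    by simp
  have field: "integral {0..x \<bullet> x} newton_field =
      2 * (2 * sqrt 2 - 2 - (primitive_min (R\<^sup>2) 2 - primitive_min (R\<^sup>2) 1))"
    unfolding xx using R by (intro integral_newton_field) simp
  have "p = 2 - 2 * c + j / 2" if "p = - d" "j = 2 * (2 * c - 2 - d)" for p c d j :: real
    using that by (simp add: field_simps)
  from this[OF np field] show ?thesis .
qed

section \<open>The lambda potential of the shell\<close>

lemma norm_kernel_difference_le:
  fixes x y :: R3
  assumes "y \<noteq> 0" "norm (x - y) \<ge> norm y / 2"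
  shows "norm ((x - y) /\<^sub>R norm (x - y) ^ 3 + y /\<^sub>R norm y ^ 3) \<le> 22 * norm x / norm y ^ 3"
proof -
  define a b where "a = norm (x - y)" and "b = norm y"
  have b: "b > 0" and ab: "a \<ge> b / 2" and a: "a > 0" using assms by (auto simp: a_def b_def)
  \<comment> \<open>The sum is the difference of the kernel at y and at y - x, so it should gain a
    factor |x|/|y|. Collecting the y terms exposes the difference of the inverse cubes, which
    contains the factor a - b, at most |x| in absolute value.\<close>
  have "(x - y) /\<^sub>R a ^ 3 + y /\<^sub>R b ^ 3 = x /\<^sub>R a ^ 3 + (inverse (b ^ 3) - inverse (a ^ 3)) *\<^sub>R y"
    by (simp add: scaleR_diff_right scaleR_diff_left)
  then have "norm ((x - y) /\<^sub>R a ^ 3 + y /\<^sub>R b ^ 3) \<le> norm x / a ^ 3 + \<bar>inverse (b ^ 3) - inverse (a ^ 3)\<bar> * b"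
    using norm_triangle_ineq[of "x /\<^sub>R a ^ 3" "(inverse (b ^ 3) - inverse (a ^ 3)) *\<^sub>R y"] a
    by (simp add: b_def divide_inverse mult.commute)
  also have "inverse (b ^ 3) - inverse (a ^ 3) = (a - b) * (1 / (a * b ^ 3) + 1 / (a\<^sup>2 * b\<^sup>2) + 1 / (a ^ 3 * b))"
    using a b by (simp add: field_simps power2_eq_square power3_eq_cube)
  also have "norm x / a ^ 3 + \<bar>(a - b) * (1 / (a * b ^ 3) + 1 / (a\<^sup>2 * b\<^sup>2) + 1 / (a ^ 3 * b))\<bar> * b
      \<le> norm x / a ^ 3 + (norm x * (1 / (a * b ^ 3) + 1 / (a\<^sup>2 * b\<^sup>2) + 1 / (a ^ 3 * b))) * b"
  proof -
    have "\<bar>a - b\<bar> \<le> norm x"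
      using norm_triangle_ineq3[of "x - y" "- y"] by (simp add: a_def b_def)
    then show ?thesis
      using a b by (intro add_left_mono mult_right_mono) (auto simp: abs_mult intro!: mult_right_mono)
  qed
  also have "\<dots> = norm x * (2 / a ^ 3 + 1 / (a * b\<^sup>2) + 1 / (a\<^sup>2 * b))"
    using a b by (simp add: field_simps power2_eq_square power3_eq_cube)
  \<comment> \<open>Each 1/a is replaced by 2/b; the total 16 + 2 + 4 is the constant 22.\<close>
  also have "\<dots> \<le> norm x * (16 / b ^ 3 + 2 / b ^ 3 + 4 / b ^ 3)"
  proof (intro mult_left_mono add_mono)
    have 1: "1 / a \<le> 2 / b" using ab a b by (simp add: field_simps)
    have 2: "1 / a\<^sup>2 \<le> 4 / b\<^sup>2" using power_mono[OF 1, of 2] a by (simp add: power_divide)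
    have 3: "1 / a ^ 3 \<le> 8 / b ^ 3" using power_mono[OF 1, of 3] a by (simp add: power_divide)
    show "2 / a ^ 3 \<le> 16 / b ^ 3" using 3 by simp
    show "1 / (a * b\<^sup>2) \<le> 2 / b ^ 3"
      using mult_right_mono[OF 1, of "1 / b\<^sup>2"] b by (simp add: power2_eq_square power3_eq_cube)
    show "1 / (a\<^sup>2 * b) \<le> 4 / b ^ 3"
      using mult_right_mono[OF 2, of "1 / b"] b by (simp add: power2_eq_square power3_eq_cube)
  qed auto
  finally show ?thesis by (simp add: a_def b_def mult.commute)
qed

lemma lambda_field_bound:
  fixes y :: R3
  shows "\<bar>lambda_field (y \<bullet> y)\<bar> * norm y \<le> indicator {1..} (y \<bullet> y) / norm y"
proof (cases "y \<bullet> y \<ge> 1")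
  case True
  have "sqrt (shell_mass (y \<bullet> y)) \<le> 1" "sqrt (shell_mass (y \<bullet> y)) \<ge> 0"
    by (auto simp: shell_mass_def)
  then have "\<bar>lambda_field (y \<bullet> y)\<bar> \<le> 1 / (norm y)\<^sup>2"
    unfolding fields_eq by (simp add: power2_norm_eq_inner divide_right_mono)
  then have "\<bar>lambda_field (y \<bullet> y)\<bar> * norm y \<le> 1 / (norm y)\<^sup>2 * norm y"
    by (intro mult_right_mono) auto
  also have "\<dots> = 1 / norm y" by (simp add: power2_eq_square)
  finally show ?thesis using True by simp
qed (simp add: lambda_field_def shell_mass_def)

text \<open>Far from x the two kernels nearly cancel and the integrand is of order 1/|y|^4; the
  kernel at x alone would leave 1/|y|^3, which is not integrable at infinity. Near x, where |x - y|
  < |y|/2, both kernels are at most 1/|x - y|^2 and |x - y| is at most |x|, so the local majorant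
  applies.\<close>

lemma integrable_lambda_kernel:
  fixes x :: R3
  shows "integrable lborel (\<lambda>y. (lambda_field (y \<bullet> y) *\<^sub>R y) \<bullet> ((x - y) /\<^sub>R norm (x - y) ^ 3 + y /\<^sub>R norm y ^ 3))"
proof (rule Bochner_Integration.integrable_bound)
  let ?g = "\<lambda>y. 22 * norm x * (indicator {1..} (y \<bullet> y) / (y \<bullet> y)\<^sup>2) +
    2 * (indicator {..(norm x)\<^sup>2} ((x - y) \<bullet> (x - y)) / ((x - y) \<bullet> (x - y)))"
  let ?K = "\<lambda>y. (x - y) /\<^sub>R norm (x - y) ^ 3 + y /\<^sub>R norm y ^ 3"
  show "integrable lborel ?g"
    by (rule Bochner_Integration.integrable_add[OF
          integrable_mult_right[OF integrable_inverse_fourth_power]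
          integrable_mult_right[OF integrable_translated_kernel]])
  show "AE y in lborel. norm ((lambda_field (y \<bullet> y) *\<^sub>R y) \<bullet> ?K y) \<le> norm (?g y)"
    \<comment> \<open>At y = x the singular term of the majorant evaluates to 0 by the division
      convention, so the point is discarded.\<close>
    using AE_lborel_singleton[of x]
  proof eventually_elim
    fix y :: R3
    assume "y \<noteq> x"
    have g1: "0 \<le> 22 * norm x * (indicator {1..} (y \<bullet> y) / (y \<bullet> y)\<^sup>2)"
      by simp
    have g2: "0 \<le> 2 * (indicator {..(norm x)\<^sup>2} ((x - y) \<bullet> (x - y)) / ((x - y) \<bullet> (x - y)) :: real)"
      by (intro mult_nonneg_nonneg divide_nonneg_nonneg inner_ge_zero) auto
    have "norm ((lambda_field (y \<bullet> y) *\<^sub>R y) \<bullet> ?K y) \<le> (\<bar>lambda_field (y \<bullet> y)\<bar> * norm y) * norm (?K y)"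
      using Cauchy_Schwarz_ineq2[of "lambda_field (y \<bullet> y) *\<^sub>R y" "?K y"]
      by (simp only: real_norm_def norm_scaleR)
    also have "\<dots> \<le> indicator {1..} (y \<bullet> y) / norm y * norm (?K y)"
      by (intro mult_right_mono lambda_field_bound) simp
    also have "\<dots> \<le> ?g y"
    proof (cases "y \<bullet> y \<ge> 1")
      case True
      then have y: "y \<noteq> 0" "norm y \<ge> 1" by (auto simp: norm_eq_sqrt_inner)
      have one: "indicator {1..} (y \<bullet> y) = (1::real)" using True by simp
      show ?thesis
      proof (cases "norm (x - y) \<ge> norm y / 2")
        case far: True
        have "1 / norm y * norm (?K y) \<le> 1 / norm y * (22 * norm x / norm y ^ 3)"
          by (intro mult_left_mono norm_kernel_difference_le y far) simp
        also have "\<dots> = 22 * norm x * (1 / (y \<bullet> y)\<^sup>2)"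
          by (simp add: power2_norm_eq_inner[symmetric] power2_eq_square power3_eq_cube)
        finally show ?thesis unfolding one by (rule add_increasing2[OF g2])
      next
        case near: False
        have "norm y \<le> norm x + norm (x - y)"
          using norm_triangle_ineq4[of x "x - y"] by simp
        then have "norm (x - y) \<le> norm x" using near by linarith
        then have ind: "indicator {..(norm x)\<^sup>2} ((x - y) \<bullet> (x - y)) = (1::real)"
          by (simp add: power2_norm_eq_inner[symmetric] power_mono)
        have V: "norm (z /\<^sub>R norm z ^ 3) = 1 / (norm z)\<^sup>2" for z :: R3
          by (simp add: power2_eq_square power3_eq_cube field_simps)
        have "norm (?K y) \<le> 1 / (norm (x - y))\<^sup>2 + 1 / (norm y)\<^sup>2"
          using norm_triangle_ineq[of "(x - y) /\<^sub>R norm (x - y) ^ 3" "y /\<^sub>R norm y ^ 3"]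
          unfolding V .
        also have "1 / (norm y)\<^sup>2 \<le> 1 / (norm (x - y))\<^sup>2"
          using near \<open>y \<noteq> x\<close> y by (intro divide_left_mono power_mono) auto
        finally have "norm (?K y) \<le> 2 * (1 / ((x - y) \<bullet> (x - y)))"
          by (simp add: power2_norm_eq_inner)
        moreover have "1 / norm y * norm (?K y) \<le> 1 * norm (?K y)"
          using y by (intro mult_right_mono) auto
        ultimately have "1 / norm y * norm (?K y) \<le> 2 * (1 / ((x - y) \<bullet> (x - y)))" by linarith
        then show ?thesis unfolding ind one by (rule add_increasing[OF g1[unfolded one]])
      qed
    qed simp
    also have "\<dots> \<le> norm (?g y)" by (simp only: real_norm_def abs_ge_self)
    finally show "norm ((lambda_field (y \<bullet> y) *\<^sub>R y) \<bullet> ?K y) \<le> norm (?g y)" .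
  qed
qed measurable

text \<open>Where the mass M is positive, |grad U^N| = M/|y|^2, so multiplication by
  \<open>lam\<close> turns M/|y|^3 into sqrt M/|y|^2, the lambda field. By the flux integral each
  sphere inside |x| counts twice its field, and 2 pi/(4 pi) is the same factor 1/2 as for the
  Newtonian part.\<close>

lemma lambda_potential_shell:
  fixes x :: R3
  assumes lam: "\<And>\<sigma>. \<sigma> > 0 \<Longrightarrow> lam \<sigma> = 1 / sqrt \<sigma>" and x: "x \<noteq> 0"
  shows "lambda_potential lam shell_density x = integral {0..x \<bullet> x} lambda_field / 2"
proof -
  define R and e where "R = norm x" and "e = x /\<^sub>R norm x"
  have R: "R > 0" "R \<noteq> 0" and e: "norm e = 1" using x by (auto simp: R_def e_def)
  have xx: "x \<bullet> x = R\<^sup>2" by (simp add: R_def power2_norm_eq_inner)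
  have yx: "y \<bullet> x = R * (y \<bullet> e)" for y using x by (simp add: R_def e_def)
  have dist: "norm (x - y) = sqrt (R\<^sup>2 - 2 * R * (y \<bullet> e) + y \<bullet> y)" for y
    unfolding R_def e_def by (rule norm_diff_axial[OF x])
  let ?K = "\<lambda>y. (x - y) /\<^sub>R norm (x - y) ^ 3 + y /\<^sub>R norm y ^ 3"
  let ?N = "newton_gradient shell_density"
  define F :: "real \<times> real \<Rightarrow> real" where
    "F = (\<lambda>(u, s). lambda_field s * ((R * u - s) / sqrt (R\<^sup>2 - 2 * R * u + s) ^ 3 + 1 / sqrt s))"
  define G where "G s = 2 * (lambda_field s * indicator {0..R\<^sup>2} s)" for s
  have Fm [measurable]: "F \<in> borel_measurable (borel \<Otimes>\<^sub>M borel)" unfolding F_def by measurable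
  have eq: "(lambda_field (y \<bullet> y) *\<^sub>R y) \<bullet> ?K y = F (y \<bullet> e, y \<bullet> y)" for y
  proof -
    have "(y \<bullet> y) * inverse (norm y ^ 3) = 1 / norm y"
      by (cases "y = 0") (simp_all add: power2_norm_eq_inner[symmetric] power2_eq_square power3_eq_cube field_simps)
    then have "y \<bullet> ?K y = (R * (y \<bullet> e) - y \<bullet> y) / norm (x - y) ^ 3 + 1 / sqrt (y \<bullet> y)"
      unfolding norm_eq_sqrt_inner[of y, symmetric] inner_add_right inner_scaleR_right inner_diff_right yx
      by (simp add: divide_inverse mult.commute)
    then show ?thesis by (simp add: F_def dist)
  qed
  have field: "lam (norm (?N y)) *\<^sub>R ?N y = lambda_field (y \<bullet> y) *\<^sub>R y" if y: "y \<noteq> 0" for y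
  proof (cases "shell_mass (y \<bullet> y) = 0")
    case True
    then show ?thesis using y by (simp add: newton_gradient_shell fields_eq)
  next
    case False
    then have m: "shell_mass (y \<bullet> y) > 0" by (simp add: shell_mass_def max_def split: if_splits)
    have ny: "norm y > 0" "y \<bullet> y = (norm y)\<^sup>2" using y by (simp_all add: power2_norm_eq_inner)
    have N: "?N y = (shell_mass (y \<bullet> y) / norm y ^ 3) *\<^sub>R y"
      using y by (simp add: newton_gradient_shell fields_eq norm_eq_sqrt_inner)
    have nN: "norm (?N y) = shell_mass (y \<bullet> y) / (norm y)\<^sup>2"
      using m ny(1) unfolding N by (simp add: power2_eq_square power3_eq_cube)
    then have "lam (norm (?N y)) = norm y / sqrt (shell_mass (y \<bullet> y))"
      using m ny(1) by (subst lam) (auto simp: real_sqrt_divide)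
    then have "lam (norm (?N y)) *\<^sub>R ?N y = (norm y / sqrt (shell_mass (y \<bullet> y)) * (shell_mass (y \<bullet> y) / norm y ^ 3)) *\<^sub>R y"
      unfolding N by simp
    also have "norm y / sqrt (shell_mass (y \<bullet> y)) * (shell_mass (y \<bullet> y) / norm y ^ 3) = sqrt (shell_mass (y \<bullet> y)) / (norm y)\<^sup>2"
      using m ny(1) by (simp add: field_simps power2_eq_square power3_eq_cube)
    also have "\<dots> = lambda_field (y \<bullet> y)" by (simp add: fields_eq ny(2))
    finally show ?thesis .
  qed
  have L: "(lam (norm (?N y)) *\<^sub>R ?N y) \<bullet> ?K y = F (y \<bullet> e, y \<bullet> y)" if "y \<noteq> 0" for y
    using field[OF that] eq[of y] by simp
  have FL: "(\<lambda>y. F (y \<bullet> e, y \<bullet> y)) \<in> borel_measurable lborel" by measurable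
  have "lambda_potential lam shell_density x = 1 / (4 * pi) * (\<integral>y. F (y \<bullet> e, y \<bullet> y) \<partial>lborel)"
    unfolding lambda_potential_def
  proof (intro arg_cong[where f = "(*) (1 / (4 * pi))"] integral_cong_AE FL)
    show "(\<lambda>y. (lam (norm (?N y)) *\<^sub>R ?N y) \<bullet> ?K y) \<in> borel_measurable lborel"
      \<comment> \<open>The closed form of the integrand holds for \<open>y \<noteq> 0\<close>;
        measurability is carried over from it across that single point.\<close>
      by (rule measurable_discrete_difference[OF FL, of "{0}"]) (use L in auto)
    show "AE y in lborel. (lam (norm (?N y)) *\<^sub>R ?N y) \<bullet> ?K y = F (y \<bullet> e, y \<bullet> y)"
      using AE_lborel_singleton[of 0] by eventually_elim (rule L)
  qed
  also have "(\<integral>y. F (y \<bullet> e, y \<bullet> y) \<partial>lborel) = pi * (\<integral>s. G s \<partial>lborel)"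
  proof (rule integral_axial[OF e Fm])
    show "G \<in> borel_measurable borel" unfolding G_def by measurable
    show "integrable lborel (\<lambda>y. F (y \<bullet> e, y \<bullet> y))"
      unfolding eq[symmetric] by (rule integrable_lambda_kernel)
    show "AE s in lborel. (\<integral>u. F (u, s) * indicator {- sqrt s..sqrt s} u \<partial>lborel) = G s"
      using AE_lborel_sqrt_neq[of R]
    proof eventually_elim
      fix s assume s: "sqrt s \<noteq> R"
      show "(\<integral>u. F (u, s) * indicator {- sqrt s..sqrt s} u \<partial>lborel) = G s"
      proof (cases "s > 0")
        case True
        have less: "sqrt s < R \<longleftrightarrow> s \<le> R\<^sup>2"
          using real_sqrt_le_iff[of s "R\<^sup>2"] R s by (auto simp del: real_sqrt_le_iff)
        have s2: "(sqrt s)\<^sup>2 = s" using True by simp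
        have "(\<integral>u. F (u, s) * indicator {- sqrt s..sqrt s} u \<partial>lborel) = lambda_field s *
            (\<integral>u. ((R * u - (sqrt s)\<^sup>2) / sqrt (R\<^sup>2 - 2 * R * u + (sqrt s)\<^sup>2) ^ 3 + 1 / sqrt s) * indicator {- sqrt s..sqrt s} u \<partial>lborel)"
          unfolding F_def prod.case mult.assoc integral_mult_right_zero s2 by (rule refl)
        also have "\<dots> = lambda_field s * (if sqrt s < R then 2 else 0)"
          using R s True by (subst integral_axial_flux) auto
        also have "\<dots> = G s"
          using True R by (simp add: G_def less)
        finally show ?thesis .
      next
        case False
        then have "lambda_field s = 0" by (simp add: lambda_field_def shell_mass_def)
        then show ?thesis by (simp add: F_def G_def)
      qed
    qed
  qed
  also have "(\<integral>s. G s \<partial>lborel) = 2 * integral {0..R\<^sup>2} lambda_field"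
    unfolding G_def by (simp add: lebesgue_integral_Icc_eq_integral continuous_on_fields)
  finally show ?thesis
    by (simp add: xx)
qed

section \<open>The weak Hessian\<close>

definition total_field :: "real \<Rightarrow> real" where
  "total_field s = newton_field s + lambda_field s"

text \<open>Branchwise derivative: the field is 0 in the cavity, s powr (-1/2) - s powr (-3/2) +
  sqrt (s - 1)/s on the shell and s powr (-3/2) + 1/s outside. At the edges 1 and 2 the value 0 is a
  convention on null spheres.\<close>

definition total_field_deriv :: "real \<Rightarrow> real" where
  "total_field_deriv s =
    (if 1 < s \<and> s < 2 then 3/2 * s powr (- (5/2)) - 1/2 * s powr (- (3/2)) + 1 / (2 * sqrt (s - 1) * s) - sqrt (s - 1) / s\<^sup>2
     else if 2 < s then - 3/2 * s powr (- (5/2)) - 1 / s\<^sup>2 else 0)"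

text \<open>Starting the integral at \<open>-1\<close>, where the field vanishes, makes \<open>0 = |0|\<^sup>2\<close> an interior point.\<close>

definition radial_potential :: "real \<Rightarrow> real" where
  "radial_potential t = 2 - 2 * sqrt 2 + integral {-1..t} total_field / 2"

lemma continuous_on_total_field: "continuous_on S total_field"
  unfolding total_field_def by (intro continuous_intros)

lemma total_field_eq_0: "s \<le> 1 \<Longrightarrow> total_field s = 0"
  by (simp add: total_field_def newton_field_def lambda_field_def shell_mass_def)

lemma inverse_powers:
  fixes s :: real
  assumes "s > 0"
  shows "s powr (- (1/2)) = 1 / sqrt s" "s powr (- (3/2)) = 1 / sqrt s ^ 3" "s powr (- (3/2)) = s powr (- (1/2)) / s"
    "s powr (- (5/2)) = s powr (- (3/2)) / s"
proof -
  show 1: "s powr (- (1/2)) = 1 / sqrt s"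
    using assms powr_minus_divide[of s "1/2"] by (simp add: powr_half_sqrt)
  show 2: "s powr (- (3/2)) = s powr (- (1/2)) / s" and "s powr (- (5/2)) = s powr (- (3/2)) / s"
    using assms powr_diff[of s "- (1/2)" 1] powr_diff[of s "- (3/2)" 1] by simp_all
  show "s powr (- (3/2)) = 1 / sqrt s ^ 3"
    unfolding 2 1 using assms by (simp add: power3_eq_cube)
qed

lemma total_field_middle:
  assumes "1 < s" "s < 2"
  shows "total_field s = s powr (- (1/2)) - s powr (- (3/2)) + sqrt (s - 1) / s"
proof -
  have "s powr (- (1/2)) = s * s powr (- (3/2))" using assms inverse_powers(3)[of s] by simp
  then show ?thesis
    using assms by (simp add: total_field_def fields_eq shell_mass_def inverse_powers(2) diff_divide_distrib)
qed

lemma DERIV_total_field: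
  assumes "s \<noteq> 1" "s \<noteq> 2"
  shows "(total_field has_real_derivative total_field_deriv s) (at s)"
proof -
  consider "s < 1" | "1 < s" "s < 2" | "2 < s" using assms by linarith
  then show ?thesis
  proof cases
    case 1
    have "((\<lambda>_. 0) has_real_derivative 0) (at s)" by simp
    then have "(total_field has_real_derivative 0) (at s)"
      by (rule has_field_derivative_transform_within_open[where S = "{..<1}"])
        (use 1 in \<open>auto simp: total_field_eq_0\<close>)
    then show ?thesis using 1 by (simp add: total_field_deriv_def)
  next
    case 2
    have "((\<lambda>s. sqrt (s - 1) / s) has_real_derivative (1 / (2 * sqrt (s - 1)) * s - sqrt (s - 1) * 1) / (s * s)) (at s)"
      using 2 by (intro DERIV_divide) (auto intro!: derivative_eq_intros simp: field_simps)
    also have "(1 / (2 * sqrt (s - 1)) * s - sqrt (s - 1) * 1) / (s * s) = 1 / (2 * sqrt (s - 1) * s) - sqrt (s - 1) / s\<^sup>2"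
      using 2 by (simp add: diff_divide_distrib power2_eq_square)
    finally have 1: "((\<lambda>s. sqrt (s - 1) / s) has_real_derivative 1 / (2 * sqrt (s - 1) * s) - sqrt (s - 1) / s\<^sup>2) (at s)" .
    have "((\<lambda>s. s powr (- (1/2)) - s powr (- (3/2))) has_real_derivative 3/2 * s powr (- (5/2)) - 1/2 * s powr (- (3/2))) (at s)"
      using 2 by (auto intro!: derivative_eq_intros)
    from DERIV_add[OF this 1]
    have "(total_field has_real_derivative
        3/2 * s powr (- (5/2)) - 1/2 * s powr (- (3/2)) + (1 / (2 * sqrt (s - 1) * s) - sqrt (s - 1) / s\<^sup>2)) (at s)"
      by (rule has_field_derivative_transform_within_open[where S = "{1<..<2}"])
        (use 2 in \<open>auto simp: total_field_middle\<close>)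
    then show ?thesis using 2 by (simp add: total_field_deriv_def add_diff_eq)
  next
    case 3
    have "((\<lambda>s. s powr (- (3/2)) + 1 / s) has_real_derivative - 3/2 * s powr (- (5/2)) - 1 / s\<^sup>2) (at s)"
      using 3 by (auto intro!: derivative_eq_intros simp: power2_eq_square)
    then have "(total_field has_real_derivative - 3/2 * s powr (- (5/2)) - 1 / s\<^sup>2) (at s)"
      by (rule has_field_derivative_transform_within_open[where S = "{2<..}"])
        (use 3 in \<open>auto simp: total_field_def fields_eq shell_mass_def inverse_powers(2)\<close>)
    then show ?thesis using 3 by (simp add: total_field_deriv_def)
  qed
qed

lemma measurable_total_field_deriv [measurable]: "total_field_deriv \<in> borel_measurable borel"
  unfolding total_field_deriv_def by measurable

text \<open>Only the term 1/(2 sqrt (s - 1) s) is unbounded. The others have coefficients at most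
  3/2, 1/2 and 1 in absolute value, so 5 is a generous constant.\<close>

lemma total_field_deriv_bound:
  "\<bar>total_field_deriv s\<bar> \<le> 5 + indicator {1<..<2} s / sqrt (s - 1)"
proof -
  have pw: "0 \<le> s powr (- (5/2))" "s powr (- (5/2)) \<le> 1" "0 \<le> s powr (- (3/2))" "s powr (- (3/2)) \<le> 1" if "s > 1"
    using that powr_mono[of "- (5/2)" 0 s] powr_mono[of "- (3/2)" 0 s] by auto
  consider "s \<le> 1 \<or> s = 2" | "1 < s" "s < 2" | "2 < s" by linarith
  then show ?thesis
  proof cases
    case 1
    then show ?thesis by (auto simp: total_field_deriv_def)
  next
    case 2
    have "1 / (2 * sqrt (s - 1) * s) \<le> 1 / sqrt (s - 1)" "0 \<le> 1 / (2 * sqrt (s - 1) * s)"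
      using 2 by (auto intro!: divide_left_mono)
    moreover have "sqrt (s - 1) / s\<^sup>2 \<le> 1"
    proof -
      have "sqrt (s - 1) \<le> 1" using 2 by simp
      also have "1 \<le> s\<^sup>2" using 2 by simp
      finally show ?thesis using 2 by (simp add: divide_le_eq)
    qed
    moreover have "0 \<le> sqrt (s - 1) / s\<^sup>2" using 2 by simp
    moreover have "\<bar>3/2 * a - 1/2 * b + c - d\<bar> \<le> 5 + q"
      if "0 \<le> a" "a \<le> 1" "0 \<le> b" "b \<le> 1" "c \<le> q" "0 \<le> c" "d \<le> 1" "0 \<le> d" for a b c d q :: real
      unfolding abs_le_iff using that by linarith
    ultimately show ?thesis
      unfolding total_field_deriv_def using 2 pw by simp
  next
    case 3
    have "1 / s\<^sup>2 \<le> 1" "0 \<le> 1 / s\<^sup>2" using 3 mult_mono[of 1 s 1 s] by (auto simp: divide_le_eq power2_eq_square)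
    moreover have "\<bar>- 3/2 * a - d\<bar> \<le> 5" if "d \<le> 1" "0 \<le> d" "0 \<le> a" "a \<le> 1" for a d :: real
      unfolding abs_le_iff using that by linarith
    ultimately have "\<bar>- 3/2 * s powr (- (5/2)) - 1 / s\<^sup>2\<bar> \<le> 5"
      using pw(1,2) 3 by (metis less_trans one_less_numeral_iff semiring_norm(76))
    then show ?thesis
      using 3 by (simp add: total_field_deriv_def)
  qed
qed

lemma DERIV_radial_potential:
  assumes "t > -1"
  shows "(radial_potential has_real_derivative total_field t / 2) (at t)"
proof -
  have "((\<lambda>x. integral {-1..x} total_field) has_real_derivative total_field t) (at t within {-1..t+1})"
    using assms by (intro integral_has_real_derivative continuous_on_total_field) auto
  then have "((\<lambda>x. integral {-1..x} total_field) has_real_derivative total_field t) (at t)"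
    using assms by (subst (asm) at_within_Icc_at) auto
  then show ?thesis
    unfolding radial_potential_def[abs_def] by (auto intro!: derivative_eq_intros)
qed

lemma mond_potential_shell:
  fixes x :: R3
  assumes "\<And>\<sigma>. \<sigma> > 0 \<Longrightarrow> lam \<sigma> = 1 / sqrt \<sigma>" and "x \<noteq> 0"
  shows "mond_potential lam shell_density x = radial_potential (x \<bullet> x)"
proof -
  have int: "f integrable_on {a..b}" if "continuous_on {a..b} f" for f :: "real \<Rightarrow> real" and a b
    using that by (rule integrable_continuous_interval)
  have "integral {-1..0::real} total_field = integral {-1..0::real} (\<lambda>_. 0)"
    by (intro integral_cong) (auto simp: total_field_eq_0)
  moreover have "integral {-1..0} total_field + integral {0..x \<bullet> x} total_field = integral {-1..x \<bullet> x} total_field"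
    by (rule Henstock_Kurzweil_Integration.integral_combine)
      (auto intro: int continuous_on_total_field)
  moreover have "integral {0..x \<bullet> x} total_field = integral {0..x \<bullet> x} newton_field + integral {0..x \<bullet> x} lambda_field"
    unfolding total_field_def
    by (rule Henstock_Kurzweil_Integration.integral_add) (auto intro: int continuous_on_fields)
  ultimately have "integral {-1..x \<bullet> x} total_field = integral {0..x \<bullet> x} newton_field + integral {0..x \<bullet> x} lambda_field"
    by simp
  then show ?thesis
    using assms by (simp add: mond_potential_def newton_potential_shell lambda_potential_shell
        radial_potential_def add_divide_distrib)
qed

text \<open>Product and chain rule for the gradient f(|x|^2) x: its derivative is 2 f' x x^T + f I,
  with f the total field.\<close>

definition shell_hessian :: "R3 \<Rightarrow> real ^ 3 ^ 3" where
  "shell_hessian x = (2 * total_field_deriv (x \<bullet> x)) *\<^sub>R (\<chi> i j. x $ i * x $ j) + total_field (x \<bullet> x) *\<^sub>R mat 1"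

lemma continuous_on_outer: "continuous_on S (\<lambda>x::R3. (\<chi> i j. x $ i * x $ j) :: real^3^3)"
  by (intro continuous_intros)

lemma measurable_total_field [measurable]: "total_field \<in> borel_measurable borel"
  by (intro borel_measurable_continuous_onI continuous_on_total_field)

lemma measurable_outer [measurable]: "(\<lambda>x::R3. (\<chi> i j. x $ i * x $ j) :: real^3^3) \<in> borel_measurable borel"
  by (intro borel_measurable_continuous_onI continuous_on_outer)

lemma measurable_shell_hessian [measurable]: "shell_hessian \<in> borel_measurable borel"
  unfolding shell_hessian_def[abs_def] by measurable

text \<open>The exponent -1/2 at the inner edge exceeds -1. This is what keeps the Hessian a locally
  integrable function.\<close>

lemma integrable_singular_bound:
  "integrable lborel (\<lambda>y::R3. indicator {1<..<2} (y \<bullet> y) / sqrt (y \<bullet> y - 1))"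
proof (rule integrable_radial)
  have "(\<integral>\<^sup>+s. ennreal (2 * pi * sqrt s) * ennreal \<bar>indicator {1<..<2} s / sqrt (s - 1)\<bar> \<partial>lborel) \<le>
    (\<integral>\<^sup>+s. ennreal (indicator {1..2} s * (4 * pi / sqrt (s - 1))) \<partial>lborel)"
  proof (rule nn_integral_mono)
    fix s :: real
    show "ennreal (2 * pi * sqrt s) * ennreal \<bar>indicator {1<..<2} s / sqrt (s - 1)\<bar> \<le> ennreal (indicator {1..2} s * (4 * pi / sqrt (s - 1)))"
    proof (cases "1 < s \<and> s < 2")
      case True
      then have "sqrt s \<le> 2" by (intro real_le_lsqrt) auto
      then have "2 * pi * sqrt s \<le> 4 * pi" by simp
      with True show ?thesis
        by (auto simp: ennreal_mult[symmetric] intro!: ennreal_leI divide_right_mono)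
    qed auto
  qed
  also have "\<dots> = ennreal (8 * pi * sqrt (2 - 1) - 8 * pi * sqrt (1 - 1))"
  proof (rule nn_integral_has_integral_lebesgue)
    show "((\<lambda>s. 4 * pi / sqrt (s - 1)) has_integral (8 * pi * sqrt (2 - 1) - 8 * pi * sqrt (1 - 1))) {1..2}"
      by (intro fundamental_theorem_of_calculus_interior)
        (auto intro!: derivative_eq_intros continuous_intros
           simp flip: has_real_derivative_iff_has_vector_derivative simp: field_simps)
  qed auto
  finally show "(\<integral>\<^sup>+s. ennreal (2 * pi * sqrt s) * ennreal \<bar>indicator {1<..<2} s / sqrt (s - 1)\<bar> \<partial>lborel) < \<infinity>"
    by (rule order.strict_trans1) simp
qed simp

lemma set_integrable_shell_hessian:
  assumes K: "compact K"
  shows "set_integrable lborel K shell_hessian"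
proof -
  let ?X = "\<lambda>x::R3. (\<chi> i j. x $ i * x $ j) :: real^3^3"
  have [measurable]: "K \<in> sets borel" using K by (simp add: borel_compact)
  obtain B where B: "\<And>x. x \<in> K \<Longrightarrow> norm (?X x) \<le> B" 
    using compact_imp_bounded[OF compact_continuous_image[OF continuous_on_outer K]]
    by (auto simp: bounded_iff)
  have 1: "integrable lborel (\<lambda>x. indicator K x *\<^sub>R ((2 * total_field_deriv (x \<bullet> x)) *\<^sub>R ?X x))"
  proof (rule Bochner_Integration.integrable_bound)
    show "integrable lborel (\<lambda>x. indicator K x *\<^sub>R (10 * \<bar>B\<bar>) + 2 * \<bar>B\<bar> * (indicator {1<..<2} (x \<bullet> x) / sqrt (x \<bullet> x - 1)))"
      using K by (intro Bochner_Integration.integrable_add integrable_mult_right[OF integrable_singular_bound] borel_integrable_compact) auto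
    show "AE x in lborel. norm (indicator K x *\<^sub>R ((2 * total_field_deriv (x \<bullet> x)) *\<^sub>R ?X x))
      \<le> norm (indicator K x *\<^sub>R (10 * \<bar>B\<bar>) + 2 * \<bar>B\<bar> * (indicator {1<..<2} (x \<bullet> x) / sqrt (x \<bullet> x - 1)))"
    proof (rule AE_I2)
      fix x :: R3
      have n: "0 \<le> indicator {1<..<2} (x \<bullet> x) / sqrt (x \<bullet> x - 1)"
        by (auto split: split_indicator)
      show "norm (indicator K x *\<^sub>R ((2 * total_field_deriv (x \<bullet> x)) *\<^sub>R ?X x))
        \<le> norm (indicator K x *\<^sub>R (10 * \<bar>B\<bar>) + 2 * \<bar>B\<bar> * (indicator {1<..<2} (x \<bullet> x) / sqrt (x \<bullet> x - 1)))"
      proof (cases "x \<in> K")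
        case True
        have "norm ((2 * total_field_deriv (x \<bullet> x)) *\<^sub>R ?X x) = 2 * \<bar>total_field_deriv (x \<bullet> x)\<bar> * norm (?X x)"
          by (simp add: abs_mult)
        also have "\<dots> \<le> 2 * (5 + indicator {1<..<2} (x \<bullet> x) / sqrt (x \<bullet> x - 1)) * \<bar>B\<bar>"
          using B[OF True] n by (intro mult_mono mult_left_mono total_field_deriv_bound) auto
        also have "\<dots> = 10 * \<bar>B\<bar> + 2 * \<bar>B\<bar> * (indicator {1<..<2} (x \<bullet> x) / sqrt (x \<bullet> x - 1))"
          by algebra
        also have "\<dots> \<le> norm \<dots>" by simp
        finally show ?thesis using True by (simp only: indicator_simps scaleR_one)
      qed simp
    qed
  qed measurable
  have 2: "integrable lborel (\<lambda>x. indicator K x *\<^sub>R (total_field (x \<bullet> x) *\<^sub>R (mat 1 :: real^3^3)))"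
    using K by (intro borel_integrable_compact continuous_intros
        continuous_on_compose2[OF continuous_on_total_field[of UNIV]]) auto
  show ?thesis
    using Bochner_Integration.integrable_add[OF 1 2]
    by (simp add: set_integrable_def shell_hessian_def scaleR_add_right)
qed

text \<open>Pairing with x x^T gives |x|^2 times the radial second derivative. Since x x^T has norm
  |x|^2, Cauchy-Schwarz bounds the norm of the Hessian below by that derivative.\<close>

lemma inner_shell_hessian_outer:
  "shell_hessian x \<bullet> (\<chi> i j. x $ i * x $ j) = 2 * total_field_deriv (x \<bullet> x) * (x \<bullet> x)\<^sup>2 + total_field (x \<bullet> x) * (x \<bullet> x)"
  by (simp add: shell_hessian_def inner_vec_def sum_3 mat_def algebra_simps power2_eq_square)

lemma norm_outer: "norm ((\<chi> i j. x $ i * x $ j) :: real^3^3) = x \<bullet> x" for x :: R3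
proof -
  let ?X = "(\<chi> i j. x $ i * x $ j) :: real^3^3"
  have "?X \<bullet> ?X = (x \<bullet> x)\<^sup>2"
    by (simp add: inner_vec_def sum_3 algebra_simps power2_eq_square)
  then show ?thesis by (simp add: norm_eq_sqrt_inner)
qed

text \<open>On the shell the radial second derivative simplifies to 2 p + 1/(w s), where p = s powr
  (-3/2) and w = sqrt (s - 1). Both terms are positive, and s < 2 gives the bound.\<close>

lemma norm_shell_hessian_ge:
  assumes "1 < x \<bullet> x" "x \<bullet> x < 2"
  shows "norm (shell_hessian x) \<ge> 1 / (2 * sqrt (x \<bullet> x - 1))"
proof -
  define s where "s = x \<bullet> x"
  have s: "1 < s" "s < 2" using assms by (simp_all add: s_def)
  define w where "w = sqrt (s - 1)"
  have w: "w > 0" "s = w\<^sup>2 + 1" using s by (simp_all add: w_def)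
  define p where "p = s powr (- (3/2))"
  have p: "p > 0" "s powr (- (1/2)) = p * s" "s powr (- (5/2)) = p / s"
    using s inverse_powers(3,4)[of s] by (simp_all add: p_def)
  have "shell_hessian x \<bullet> (\<chi> i j. x $ i * x $ j) \<le> norm (shell_hessian x) * s"
    using norm_cauchy_schwarz[of "shell_hessian x" "\<chi> i j. x $ i * x $ j"] by (simp add: norm_outer s_def)
  then have "(2 * total_field_deriv s * s + total_field s) * s \<le> norm (shell_hessian x) * s"
    by (simp add: inner_shell_hessian_outer s_def[symmetric] algebra_simps power2_eq_square)
  then have "2 * total_field_deriv s * s + total_field s \<le> norm (shell_hessian x)"
    using s by simp
  moreover have "2 * total_field_deriv s * s + total_field s = 2 * p + (1 / w - w / s)"
    using s w(1) by (simp add: total_field_deriv_def total_field_middle p p_def[symmetric] w_def[symmetric] field_simps power2_eq_square)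
  moreover have "1 / w - w / s = (s - w\<^sup>2) / (w * s)"
    using s w(1) by (simp add: diff_divide_distrib power2_eq_square)
  then have "1 / w - w / s = 1 / (w * s)"
    using w(2) by simp
  moreover have "1 / (2 * w) \<le> 1 / (w * s)"
    using s w(1) by (intro divide_left_mono) auto
  ultimately show ?thesis
    using p(1) unfolding w_def s_def by (smt (verit))
qed

text \<open>Along a unit direction the square norm is a monic quadratic in t; given one solution
  \<open>t0\<close>, Vieta yields the only other candidate. Tangent lines are covered as
  well.\<close>

lemma finite_line_sphere:
  fixes x e :: R3
  assumes "e \<bullet> e = 1"
  shows "finite {t. (x + t *\<^sub>R e) \<bullet> (x + t *\<^sub>R e) = c}"
proof (cases "{t. (x + t *\<^sub>R e) \<bullet> (x + t *\<^sub>R e) = c} = {}")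
  case False
  have expand: "(x + t *\<^sub>R e) \<bullet> (x + t *\<^sub>R e) = x \<bullet> x + 2 * t * (x \<bullet> e) + t\<^sup>2" for t
    by (simp add: inner_add_left inner_add_right assms inner_commute[of e x] power2_eq_square algebra_simps)
  from False obtain t0 where t0: "x \<bullet> x + 2 * t0 * (x \<bullet> e) + t0\<^sup>2 = c" by (auto simp: expand)
  have "{t. (x + t *\<^sub>R e) \<bullet> (x + t *\<^sub>R e) = c} \<subseteq> {t0, - t0 - 2 * (x \<bullet> e)}"
  proof
    fix t assume "t \<in> {t. (x + t *\<^sub>R e) \<bullet> (x + t *\<^sub>R e) = c}"
    then have "x \<bullet> x + 2 * t * (x \<bullet> e) + t\<^sup>2 = x \<bullet> x + 2 * t0 * (x \<bullet> e) + t0\<^sup>2"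
      using t0 by (simp add: expand)
    then have "(t - t0) * (t + t0 + 2 * (x \<bullet> e)) = 0" by algebra
    then show "t \<in> {t0, - t0 - 2 * (x \<bullet> e)}" by auto
  qed
  then show ?thesis by (rule finite_subset) simp
qed simp

lemma DERIV_line_inner:
  fixes x e :: R3
  shows "((\<lambda>t. (x + t *\<^sub>R e) \<bullet> (x + t *\<^sub>R e)) has_real_derivative 2 * ((x + t *\<^sub>R e) \<bullet> e)) (at t)"
proof -
  have *: "(\<lambda>t. (x + t *\<^sub>R e) \<bullet> (x + t *\<^sub>R e)) = (\<lambda>t. x \<bullet> x + 2 * t * (x \<bullet> e) + t\<^sup>2 * (e \<bullet> e))"
    by (auto simp: inner_add_left inner_add_right inner_commute[of e x] power2_eq_square algebra_simps)
  show ?thesis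
    unfolding * by (auto intro!: derivative_eq_intros simp: inner_add_left)
qed

lemma DERIV_line_radial_potential:
  "((\<lambda>t. radial_potential ((x + t *\<^sub>R axis i 1) \<bullet> (x + t *\<^sub>R axis i 1))) has_real_derivative
    total_field ((x + t *\<^sub>R axis i 1) \<bullet> (x + t *\<^sub>R axis i 1)) * (x + t *\<^sub>R axis i 1) $ i) (at t)"
  for x :: R3
proof -
  let ?y = "x + t *\<^sub>R axis i 1"
  have "?y \<bullet> ?y > -1" by (rule less_le_trans[OF _ inner_ge_zero]) simp
  from DERIV_chain2[OF DERIV_radial_potential[OF this] DERIV_line_inner]
  show ?thesis by (rule DERIV_cong) (simp add: inner_axis)
qed

lemma DERIV_line_gradient:
  fixes x :: R3
  defines "y \<equiv> \<lambda>j t. x + t *\<^sub>R axis j 1"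
  assumes "y j t \<bullet> y j t \<notin> {1, 2}"
  shows "((\<lambda>t. total_field (y j t \<bullet> y j t) * y j t $ i) has_real_derivative shell_hessian (y j t) $ i $ j) (at t)"
proof -
  have 1: "((\<lambda>t. total_field (y j t \<bullet> y j t)) has_real_derivative
      total_field_deriv (y j t \<bullet> y j t) * (2 * (y j t \<bullet> axis j 1))) (at t)"
    using assms(2) unfolding y_def by (intro DERIV_chain2[OF DERIV_total_field DERIV_line_inner]) auto
  have 2: "((\<lambda>t. y j t $ i) has_real_derivative axis j 1 $ i) (at t)"
    unfolding y_def by (auto intro!: derivative_eq_intros)
  have "(axis j 1 :: R3) $ i = (if i = j then 1 else 0)"
    by (simp add: axis_def)
  then show ?thesis
    by (intro DERIV_cong[OF DERIV_mult[OF 1 2]]) (simp add: shell_hessian_def inner_axis mat_def)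
qed

lemma continuous_on_radial_potential: "continuous_on UNIV (\<lambda>x::R3. radial_potential (x \<bullet> x))"
proof -
  have "isCont radial_potential (x \<bullet> x)" for x :: R3
    by (rule DERIV_isCont[OF DERIV_radial_potential], rule less_le_trans[OF _ inner_ge_zero]) simp
  moreover have "isCont (\<lambda>x. x \<bullet> x) x" for x :: R3
    by (intro continuous_intros)
  ultimately show ?thesis
    by (intro continuous_at_imp_continuous_on ballI isCont_o2[of _ "\<lambda>x. x \<bullet> x" radial_potential])
qed

lemma continuous_on_gradient: "continuous_on UNIV (\<lambda>x::R3. total_field (x \<bullet> x) * x $ i)"
  by (intro continuous_intros continuous_on_compose2[OF continuous_on_total_field[of UNIV]]) auto

text \<open>Two integrations by parts: U times \<open>partial_deriv j \<phi>\<close> along axis i,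
  then the i-th gradient component times \<open>\<phi>\<close> along axis j. The first has no
  exceptional points because U is differentiable everywhere; in the second each line avoids the two
  spheres except at finitely many t.\<close>

lemma weak_hessian_radial_potential:
  fixes \<phi> :: "R3 \<Rightarrow> real"
  assumes "test_function \<phi>"
  shows "(\<integral>x. radial_potential (x \<bullet> x) * partial_deriv i (partial_deriv j \<phi>) x \<partial>lborel) =
    (\<integral>x. shell_hessian x $ i $ j * \<phi> x \<partial>lborel)"
proof -
  let ?U = "\<lambda>x::R3. radial_potential (x \<bullet> x)" and ?g = "\<lambda>x::R3. total_field (x \<bullet> x) * x $ i"
  let ?\<phi>j = "partial_deriv j \<phi>" and ?\<phi>ij = "partial_deriv i (partial_deriv j \<phi>)"
  have d: "foldr partial_deriv is \<phi> differentiable_on UNIV" for "is"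
    using assms by (auto simp: test_function_def)
  have diff: "\<phi> differentiable_on UNIV" "?\<phi>j differentiable_on UNIV" "?\<phi>ij differentiable_on UNIV"
    using d[of "[]"] d[of "[j]"] d[of "[i, j]"] by simp_all
  then have cont: "continuous_on UNIV \<phi>" "continuous_on UNIV ?\<phi>j" "continuous_on UNIV ?\<phi>ij"
    by (auto intro: differentiable_imp_continuous_on)
  have K: "compact (supp \<phi>)" "closed (supp \<phi>)"
    using assms by (auto simp: test_function_def supp_def)
  have z: "\<phi> x = 0" if "x \<notin> supp \<phi>" for x
    using that closure_subset[of "{x. \<phi> x \<noteq> 0}"] by (auto simp: supp_def)
  have zj: "?\<phi>j x = 0" if "x \<notin> supp \<phi>" for x
    by (rule partial_deriv_eq_0_outside[OF K(2) z that])
  have zij: "?\<phi>ij x = 0" if "x \<notin> supp \<phi>" for x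
    by (rule partial_deriv_eq_0_outside[OF K(2) zj that])
  have line: "continuous_on {0..1} (\<lambda>t. F (x + t *\<^sub>R e))" if "continuous_on UNIV F" for F :: "R3 \<Rightarrow> real" and x e
    by (rule continuous_on_compose2[OF that]) (auto intro!: continuous_intros)
  have i1: "integrable lborel (\<lambda>x. ?U x * ?\<phi>j x)" "integrable lborel (\<lambda>x. ?g x * ?\<phi>j x)"
    "integrable lborel (\<lambda>x. ?U x * ?\<phi>ij x)" "integrable lborel (\<lambda>x. ?g x * \<phi> x)"
    by (rule integrable_continuous_compact_support[OF K(1)];
        simp add: z zj zij continuous_on_mult cont continuous_on_gradient continuous_on_radial_potential)+
  have i2: "integrable lborel (\<lambda>x. shell_hessian x $ i $ j * \<phi> x)"
  proof -
    obtain B where B: "\<And>x. x \<in> supp \<phi> \<Longrightarrow> norm (\<phi> x) \<le> B"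
      using compact_imp_bounded[OF compact_continuous_image[OF continuous_on_subset[OF cont(1)] K(1)]]
      by (auto simp: bounded_iff)
    have [measurable]: "\<phi> \<in> borel_measurable borel"
      by (rule borel_measurable_continuous_onI[OF cont(1)])
    have [measurable]: "(\<lambda>x. shell_hessian x $ i $ j) \<in> borel_measurable borel"
      by (rule borel_measurable_continuous_on[where f = "\<lambda>H. H $ i $ j"]) (auto intro!: continuous_intros)
    show ?thesis
    proof (rule Bochner_Integration.integrable_bound)
      show "integrable lborel (\<lambda>x. B *\<^sub>R (indicator (supp \<phi>) x *\<^sub>R shell_hessian x))"
        using set_integrable_shell_hessian[OF K(1)] unfolding set_integrable_def by (intro integrable_scaleR_right)
      show "AE x in lborel. norm (shell_hessian x $ i $ j * \<phi> x) \<le> norm (B *\<^sub>R (indicator (supp \<phi>) x *\<^sub>R shell_hessian x))"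
      proof (rule AE_I2)
        fix x
        show "norm (shell_hessian x $ i $ j * \<phi> x) \<le> norm (B *\<^sub>R (indicator (supp \<phi>) x *\<^sub>R shell_hessian x))"
        proof (cases "x \<in> supp \<phi>")
          case True
          have "\<bar>shell_hessian x $ i $ j\<bar> \<le> norm (shell_hessian x $ i)"
            using component_le_norm_cart[of "shell_hessian x $ i" j] by simp
          also have "\<dots> \<le> norm (shell_hessian x)" by (rule Finite_Cartesian_Product.norm_nth_le)
          finally have "\<bar>shell_hessian x $ i $ j\<bar> * \<bar>\<phi> x\<bar> \<le> norm (shell_hessian x) * \<bar>B\<bar>"
            using B[OF True] by (intro mult_mono) auto
          then show ?thesis
            using True by (simp add: abs_mult mult.commute[of "\<bar>B\<bar>"])
        qed (simp add: z)
      qed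
    qed measurable
  qed
  have "(\<integral>x. ?g x * ?\<phi>j x + ?U x * ?\<phi>ij x \<partial>lborel) = 0"
  proof (rule integral_directional_derivative_eq_0[OF i1(1) Bochner_Integration.integrable_add[OF i1(2,3)]])
    show "continuous_on {0..1} (\<lambda>t. ?U (x + t *\<^sub>R axis i 1) * ?\<phi>j (x + t *\<^sub>R axis i 1))" for x
      by (intro line continuous_on_mult cont continuous_on_radial_potential)
    show "\<exists>S. finite S \<and> (\<forall>t\<in>{0<..<1} - S. ((\<lambda>t. ?U (x + t *\<^sub>R axis i 1) * ?\<phi>j (x + t *\<^sub>R axis i 1)) has_real_derivative
        ?g (x + t *\<^sub>R axis i 1) * ?\<phi>j (x + t *\<^sub>R axis i 1) + ?U (x + t *\<^sub>R axis i 1) * ?\<phi>ij (x + t *\<^sub>R axis i 1)) (at t))" for x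
      by (intro exI[of _ "{}"] conjI ballI finite.emptyI
          DERIV_cong[OF DERIV_mult[OF DERIV_line_radial_potential partial_deriv_line[OF diff(2)]]])
        (simp add: mult.commute add.commute)
  qed
  then have 1: "(\<integral>x. ?U x * ?\<phi>ij x \<partial>lborel) = - (\<integral>x. ?g x * ?\<phi>j x \<partial>lborel)"
    using Bochner_Integration.integral_add[OF i1(2,3)] by simp
  have "(\<integral>x. shell_hessian x $ i $ j * \<phi> x + ?g x * ?\<phi>j x \<partial>lborel) = 0"
  proof (rule integral_directional_derivative_eq_0[OF i1(4) Bochner_Integration.integrable_add[OF i2 i1(2)]])
    show "continuous_on {0..1} (\<lambda>t. ?g (x + t *\<^sub>R axis j 1) * \<phi> (x + t *\<^sub>R axis j 1))" for x
      by (rule line[of "\<lambda>x. ?g x * \<phi> x"]) (intro continuous_on_mult[OF continuous_on_gradient] cont)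
    show "\<exists>S. finite S \<and> (\<forall>t\<in>{0<..<1} - S. ((\<lambda>t. ?g (x + t *\<^sub>R axis j 1) * \<phi> (x + t *\<^sub>R axis j 1)) has_real_derivative
        shell_hessian (x + t *\<^sub>R axis j 1) $ i $ j * \<phi> (x + t *\<^sub>R axis j 1) + ?g (x + t *\<^sub>R axis j 1) * ?\<phi>j (x + t *\<^sub>R axis j 1)) (at t))" for x
    proof (intro exI conjI ballI)
      let ?S = "\<lambda>c. {t. (x + t *\<^sub>R axis j 1) \<bullet> (x + t *\<^sub>R axis j 1) = c}"
      show "finite (?S 1 \<union> ?S 2)"
        by (intro finite_UnI finite_line_sphere) (simp_all add: inner_axis_axis)
      fix t assume "t \<in> {0<..<1} - (?S 1 \<union> ?S 2)"
      then have "(x + t *\<^sub>R axis j 1) \<bullet> (x + t *\<^sub>R axis j 1) \<notin> {1, 2}" by auto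
      from DERIV_mult[OF DERIV_line_gradient[OF this] partial_deriv_line[OF diff(1)]]
      show "((\<lambda>t. ?g (x + t *\<^sub>R axis j 1) * \<phi> (x + t *\<^sub>R axis j 1)) has_real_derivative
        shell_hessian (x + t *\<^sub>R axis j 1) $ i $ j * \<phi> (x + t *\<^sub>R axis j 1) + ?g (x + t *\<^sub>R axis j 1) * ?\<phi>j (x + t *\<^sub>R axis j 1)) (at t)"
        by (rule DERIV_cong) (simp add: mult.commute)
    qed
  qed
  then have "(\<integral>x. shell_hessian x $ i $ j * \<phi> x \<partial>lborel) = - (\<integral>x. ?g x * ?\<phi>j x \<partial>lborel)"
    using Bochner_Integration.integral_add[OF i2 i1(2)] by simp
  with 1 show ?thesis by simp
qed

section \<open>Divergence of the L^q norms\<close>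

lemma not_integrable_reciprocal: 
  "(\<integral>\<^sup>+s. ennreal (1 / (s - 1)) * indicator {1<..5/4} s \<partial>lborel) = \<infinity>"
proof (rule ccontr)
  assume "(\<integral>\<^sup>+s. ennreal (1 / (s - 1)) * indicator {1<..5/4} s \<partial>lborel) \<noteq> \<infinity>"
  then obtain r where r: "r \<ge> 0" "(\<integral>\<^sup>+s. ennreal (1 / (s - 1)) * indicator {1<..5/4} s \<partial>lborel) = ennreal r"
    by (cases "\<integral>\<^sup>+s. ennreal (1 / (s - 1)) * indicator {1<..5/4} s \<partial>lborel") auto
  \<comment> \<open>Solves \<open>ln (1/4) - ln d = r + 1\<close>, so the integral over [1 + d, 5/4]
    already exceeds the supposed value r.\<close>
  define d where "d = exp (- (r + 1)) / 4"
  have "exp (- (r + 1)) \<le> 1" using r(1) by simp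
  then have d: "0 < d" "d \<le> 1/4" by (simp_all add: d_def)
  have "ennreal (ln (5/4 - 1) - ln ((1 + d) - 1)) = (\<integral>\<^sup>+s. ennreal (1 / (s - 1)) * indicator {1 + d..5/4} s \<partial>lborel)"
    using d by (intro nn_integral_FTC_Icc[symmetric]) (auto intro!: derivative_eq_intros)
  also have "\<dots> \<le> ennreal r"
    unfolding r(2)[symmetric] using d by (intro nn_integral_mono) (auto split: split_indicator)
  also have "ln (5/4 - 1) - ln ((1 + d) - 1) = r + 1"
    using d by (simp add: d_def ln_div)
  finally show False using r(1) by simp
qed

text \<open>For |x|^2 in (1, 5/4] the lower bound a = 1/(2 sqrt (|x|^2 - 1)) is at least 1, which is
  where 5/4 comes from. Hence a powr q is at least a^2 = 1/(4 (|x|^2 - 1)), and one logarithmic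
  divergence settles all q at once.\<close>

lemma nn_integral_shell_hessian_powr:
  assumes "q \<ge> 2"
  shows "(\<integral>\<^sup>+x. ennreal (norm (shell_hessian x) powr q) \<partial>lborel) = \<infinity>"
proof -
  let ?f = "\<lambda>s. ennreal (1 / (4 * (s - 1))) * indicator {1<..5/4} s"
  have "\<infinity> = (\<integral>\<^sup>+s. ennreal (1 / (s - 1)) * indicator {1<..5/4} s \<partial>lborel)"
    by (simp add: not_integrable_reciprocal)
  also have "\<dots> \<le> (\<integral>\<^sup>+s. ennreal (2 * pi * sqrt s) * ?f s \<partial>lborel)"
  proof (intro nn_integral_mono)
    fix s :: real
    show "ennreal (1 / (s - 1)) * indicator {1<..5/4} s \<le> ennreal (2 * pi * sqrt s) * ?f s"
    proof (cases "1 < s \<and> s \<le> 5/4")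
      case True
      \<comment> \<open>The volume weight compensates the factor 1/4 in \<open>?f\<close>.\<close>
      have "4 \<le> 2 * pi * sqrt s"
        using mult_mono[of 4 "2 * pi" 1 "sqrt s"] pi_ge_two True by simp
      then have "4 * (1 / (4 * (s - 1))) \<le> 2 * pi * sqrt s * (1 / (4 * (s - 1)))"
        using True by (intro mult_right_mono) auto
      moreover have "4 * (1 / (4 * (s - 1))) = 1 / (s - 1)"
        using True by (simp add: field_simps)
      ultimately have "ennreal (1 / (s - 1)) \<le> ennreal (2 * pi * sqrt s * (1 / (4 * (s - 1))))"
        by (metis ennreal_leI)
      also have "\<dots> = ennreal (2 * pi * sqrt s) * ennreal (1 / (4 * (s - 1)))"
        using True by (intro ennreal_mult) auto
      finally show ?thesis using True by simp
    qed auto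
  qed
  also have "\<dots> = (\<integral>\<^sup>+x. ?f (x \<bullet> x) \<partial>(lborel :: R3 measure))"
    by (rule nn_integral_radial[symmetric]) measurable
  also have "\<dots> \<le> (\<integral>\<^sup>+x. ennreal (norm (shell_hessian x) powr q) \<partial>lborel)"
  proof (rule nn_integral_mono)
    fix x :: R3
    show "?f (x \<bullet> x) \<le> ennreal (norm (shell_hessian x) powr q)"
    proof (cases "1 < x \<bullet> x \<and> x \<bullet> x \<le> 5/4")
      case True
      define a where "a = 1 / (2 * sqrt (x \<bullet> x - 1))"
      have "sqrt (x \<bullet> x - 1) \<le> 1/2"
        by (rule real_le_lsqrt) (use True in \<open>auto simp: power2_eq_square\<close>)
      then have a: "a \<ge> 1" using True by (simp add: a_def)
      have "1 / (4 * (x \<bullet> x - 1)) = a\<^sup>2"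
        using True by (simp add: a_def power_divide power_mult_distrib)
      also have "\<dots> = a powr 2" using a by simp
      also have "\<dots> \<le> a powr q" using a assms by (intro powr_mono) auto
      also have "\<dots> \<le> norm (shell_hessian x) powr q"
        using norm_shell_hessian_ge[of x] True a assms by (intro powr_mono2) (auto simp: a_def)
      finally show ?thesis using True by (simp add: ennreal_leI)
    qed auto
  qed
  finally show ?thesis by (simp add: top.extremum_unique)
qed

lemma Lq_norm_shell_hessian: "q \<ge> 2 \<Longrightarrow> Lq_norm q shell_hessian = \<infinity>"
  by (simp add: Lq_norm_def nn_integral_shell_hessian_powr)

text \<open>The closed form of the potential is available for \<open>x \<noteq> 0\<close>, where the
  direction x/|x| exists. Weak derivatives ignore the null set {0}, so the radial representative can
  be substituted.\<close>

lemma has_weak_hessian_mond_potential_shell: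
  assumes lam: "\<And>\<sigma>. \<sigma> > 0 \<Longrightarrow> lam \<sigma> = 1 / sqrt \<sigma>"
  shows "has_weak_hessian (mond_potential lam shell_density) shell_hessian"
proof -
  let ?U = "\<lambda>x::R3. radial_potential (x \<bullet> x)" and ?V = "mond_potential lam shell_density"
  have eq: "?V x = ?U x" if "x \<noteq> 0" for x
    using mond_potential_shell[OF lam that] .
  have Um [measurable]: "?U \<in> borel_measurable borel"
    by (rule borel_measurable_continuous_onI[OF continuous_on_radial_potential])
  have Vm [measurable]: "?V \<in> borel_measurable borel"
    by (rule measurable_discrete_difference[OF Um, of "{0}"]) (use eq in auto)
  have AE: "AE x in lborel. ?V x = ?U x"
    using AE_lborel_singleton[of 0] by eventually_elim (rule eq)
  have "set_integrable lborel K ?V" if K: "compact K" for K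
  proof -
    have [measurable]: "K \<in> sets borel" using K by (simp add: borel_compact)
    have "integrable lborel (\<lambda>x. indicator K x *\<^sub>R ?U x)"
      using K by (intro borel_integrable_compact continuous_on_subset[OF continuous_on_radial_potential]) auto
    moreover have "integrable lborel (\<lambda>x. indicator K x *\<^sub>R ?V x) \<longleftrightarrow> integrable lborel (\<lambda>x. indicator K x *\<^sub>R ?U x)"
      by (rule integrable_cong_AE; (measurable)?) (use AE in eventually_elim, simp)
    ultimately show ?thesis by (simp add: set_integrable_def)
  qed
  moreover have "(\<integral>x. ?V x * partial_deriv i (partial_deriv j \<phi>) x \<partial>lborel) = (\<integral>x. shell_hessian x $ i $ j * \<phi> x \<partial>lborel)"
    if \<phi>: "test_function \<phi>" for \<phi> i j
  proof -
    have "foldr partial_deriv [i, j] \<phi> differentiable_on UNIV"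
      using \<phi> unfolding test_function_def by blast
    then have "continuous_on UNIV (partial_deriv i (partial_deriv j \<phi>))"
      by (auto intro: differentiable_imp_continuous_on)
    then have [measurable]: "partial_deriv i (partial_deriv j \<phi>) \<in> borel_measurable borel"
      by (rule borel_measurable_continuous_onI)
    have "(\<integral>x. ?V x * partial_deriv i (partial_deriv j \<phi>) x \<partial>lborel) = (\<integral>x. ?U x * partial_deriv i (partial_deriv j \<phi>) x \<partial>lborel)"
      by (rule integral_cong_AE; (measurable)?) (use AE in eventually_elim, simp)
    then show ?thesis using weak_hessian_radial_potential[OF \<phi>] by simp
  qed
  ultimately show ?thesis
    by (auto simp: has_weak_hessian_def locally_integrable_def set_integrable_shell_hessian)
qed

lemma shell_density_properties:
  "in_L1_Linf shell_density" "spherically_symmetric shell_density" "shell_density x \<ge> 0"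
  "supp shell_density \<subseteq> ball 0 2" "Linf_norm shell_density \<le> 1"
proof -
  show L: "Linf_norm shell_density \<le> 1"
    unfolding Linf_norm_def using shell_profile_bounds
    by (intro esssup_I AE_I2) (auto simp: shell_density_def)
  have subset: "{x. shell_density x \<noteq> 0} \<subseteq> cball 0 (sqrt 2)"
    by (auto simp: shell_density_def shell_profile_def norm_eq_sqrt_inner split: split_indicator_asm)
  have "integrable lborel shell_density"
  proof (rule Bochner_Integration.integrable_bound)
    show "integrable lborel (\<lambda>x::R3. indicator (cball 0 (sqrt 2)) x *\<^sub>R (1::real))"
      by (intro borel_integrable_compact) auto
    show "AE x in lborel. norm (shell_density x) \<le> norm (indicator (cball 0 (sqrt 2)) x *\<^sub>R (1::real))"
    proof (rule AE_I2)
      fix x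
      show "norm (shell_density x) \<le> norm (indicator (cball 0 (sqrt 2)) x *\<^sub>R (1::real))"
      proof (cases "shell_density x = 0")
        case False
        then have "x \<in> cball 0 (sqrt 2)" using subset by blast
        then show ?thesis
          using shell_profile_bounds[of "x \<bullet> x"] by (simp add: shell_density_def)
      qed simp
    qed
  qed measurable
  moreover have "Linf_norm shell_density < \<infinity>"
    using L by (rule order.strict_trans1) simp
  ultimately show "in_L1_Linf shell_density" by (simp add: in_L1_Linf_def)
  show "spherically_symmetric shell_density"
    by (simp add: spherically_symmetric_def shell_density_def power2_norm_eq_inner[symmetric])
  show "shell_density x \<ge> 0" by (simp add: shell_density_def shell_profile_bounds)
  \<comment> \<open>The shell ends at radius sqrt 2 < 2, so even the closed support stays in the
    open ball.\<close>
  have "supp shell_density \<subseteq> cball 0 (sqrt 2)"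
    unfolding supp_def by (rule closure_minimal[OF subset]) simp
  also have "\<dots> \<subseteq> ball 0 2"
    using real_less_lsqrt[of 2 2] by auto
  finally show "supp shell_density \<subseteq> ball 0 2" .
qed

theorem lemma5p4:
  fixes lam :: "real \<Rightarrow> real"
  assumes lam: "\<And>\<sigma>. \<sigma> > 0 \<Longrightarrow> lam \<sigma> = 1 / sqrt \<sigma>"
  shows "\<exists>(\<rho> :: nat \<Rightarrow> R3 \<Rightarrow> real) (D2U :: nat \<Rightarrow> R3 \<Rightarrow> real ^ 3 ^ 3).
    (\<forall>n. in_L1_Linf (\<rho> n) \<and> spherically_symmetric (\<rho> n) \<and>
         (\<forall>x. \<rho> n x \<ge> 0) \<and> supp (\<rho> n) \<subseteq> ball 0 2 \<and> Linf_norm (\<rho> n) \<le> 1 \<and>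
         has_weak_hessian (mond_potential lam (\<rho> n)) (D2U n)) \<and>
    (\<forall>q::real. 2 < q \<and> q < 6 \<longrightarrow> (\<lambda>n. Lq_norm q (D2U n)) \<longlonglongrightarrow> \<infinity>)"
proof (intro exI conjI allI impI)
  \<comment> \<open>Every term is infinite, so the limit is that of a constant sequence; the
    \<open>show\<close> below also fixes the witness \<open>D2U\<close> as constantly
    \<open>shell_hessian\<close>.\<close>
  fix q :: real assume "2 < q \<and> q < 6"
  then show "(\<lambda>n::nat. Lq_norm q shell_hessian) \<longlonglongrightarrow> \<infinity>"
    by (simp add: Lq_norm_shell_hessian)
qed (use shell_density_properties has_weak_hessian_mond_potential_shell[OF lam] in auto)

end
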